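(* Let $\mathcal{A}$ be an abelian length category and $\mathcal{C}$ a subcategory of $\mathcal{A}$. Then the following are equivalent. (1) $\mathcal{C}$ is an ICE-closed subcategory of $\mathcal{A}$. (2) There is some wide subcategory $\mathcal{W}$ of $\mathcal{A}$ such that $\mathcal{C}$ is a torsion class in $\mathcal{W}$.
   Context: All categories are skeletally small. An abelian length category is an abelian category in which every object has finite length. All subcategories are full, closed under isomorphisms, and contain the zero object. A subcategory $\mathcal{C}$ of $\mathcal{A}$ is closed under extensions if for every short exact sequence $0\to L\to M\to N\to 0$ in $\mathcal{A}$, $L,N\in\mathcal{C}$ implies $M\in\mathcal{C}$; it is closed under images (resp. kernels, cokernels) if for every morphism $\varphi\colon C_1\to C_2$ in $\mathcal{A}$ with $C_1,C_2\in\mathcal{C}$, the image (resp. kernel, cokernel) of $\varphi$ taken in $\mathcal{A}$ belongs to $\mathcal{C}$. A wide subcategory is one closed under extensions, kernels and cokernels; it is itself an abelian length category. An ICE-closed subcategory is one closed under images, cokernels and extensions. A torsion class in an abelian length category $\mathcal{W}$ is a subcategory of $\mathcal{W}$ closed under extensions and under quotients in $\mathcal{W}$. *)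

theory Defs
  imports "HOL-Algebra.Group"
begin

text \<open>
  Categories are small, with objects and arrows taken from two arbitrary types; the fields are
  meaningful only on \<open>Obj\<close>, on \<open>Arr\<close>, on composable pairs (\<open>Comp\<close>, written \<open>g \<odot> f\<close>
  for \<open>g\<close> after \<open>f\<close>) and on parallel pairs (\<open>Add\<close>).
\<close>

record ('o, 'm) additive_data =
  Obj :: "'o set"
  Arr :: "'m set"
  Dom :: "'m \<Rightarrow> 'o"
  Cod :: "'m \<Rightarrow> 'o"
  Id :: "'o \<Rightarrow> 'm"
  Comp :: "'m \<Rightarrow> 'm \<Rightarrow> 'm" (infixl "\<odot>\<index>" 70)
  Add :: "'m \<Rightarrow> 'm \<Rightarrow> 'm" (infixl "\<boxplus>\<index>" 65)
  Zero :: "'o \<Rightarrow> 'o \<Rightarrow> 'm"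

definition Hom :: "('o, 'm) additive_data \<Rightarrow> 'o \<Rightarrow> 'o \<Rightarrow> 'm set" where
  "Hom A X Y = {f \<in> Arr A. Dom A f = X \<and> Cod A f = Y}"

definition hom_group :: "('o, 'm) additive_data \<Rightarrow> 'o \<Rightarrow> 'o \<Rightarrow> 'm monoid" where
  "hom_group A X Y = \<lparr>carrier = Hom A X Y, mult = Add A, one = Zero A X Y\<rparr>"

locale category =
  fixes A :: "('o, 'm) additive_data" (structure)
  assumes Dom_closed: "f \<in> Arr A \<Longrightarrow> Dom A f \<in> Obj A"
    and Cod_closed: "f \<in> Arr A \<Longrightarrow> Cod A f \<in> Obj A"
    and Id_closed: "X \<in> Obj A \<Longrightarrow> Id A X \<in> Hom A X X"
    and Comp_closed: "\<lbrakk>f \<in> Hom A X Y; g \<in> Hom A Y Z\<rbrakk> \<Longrightarrow> g \<odot> f \<in> Hom A X Z"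
    and Comp_Id_right: "f \<in> Hom A X Y \<Longrightarrow> f \<odot> Id A X = f"
    and Comp_Id_left: "f \<in> Hom A X Y \<Longrightarrow> Id A Y \<odot> f = f"
    and Comp_assoc: "\<lbrakk>f \<in> Hom A W X; g \<in> Hom A X Y; h \<in> Hom A Y Z\<rbrakk>
      \<Longrightarrow> (h \<odot> g) \<odot> f = h \<odot> (g \<odot> f)"

locale preadditive_category = category +
  assumes hom_comm_group: "\<lbrakk>X \<in> Obj A; Y \<in> Obj A\<rbrakk> \<Longrightarrow> comm_group (hom_group A X Y)"
    and Comp_Add_right: "\<lbrakk>f \<in> Hom A X Y; f' \<in> Hom A X Y; g \<in> Hom A Y Z\<rbrakk>
      \<Longrightarrow> g \<odot> (f \<boxplus> f') = (g \<odot> f) \<boxplus> (g \<odot> f')"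
    and Comp_Add_left: "\<lbrakk>f \<in> Hom A X Y; g \<in> Hom A Y Z; g' \<in> Hom A Y Z\<rbrakk>
      \<Longrightarrow> (g \<boxplus> g') \<odot> f = (g \<odot> f) \<boxplus> (g' \<odot> f)"

definition zero_object :: "('o, 'm) additive_data \<Rightarrow> 'o \<Rightarrow> bool" where
  "zero_object A Z \<longleftrightarrow> Z \<in> Obj A \<and>
    (\<forall>X\<in>Obj A. (\<exists>!f. f \<in> Hom A X Z) \<and> (\<exists>!f. f \<in> Hom A Z X))"

text \<open>
  The equations \<open>p\<^sub>2 \<odot> i\<^sub>1 = 0\<close> and \<open>p\<^sub>1 \<odot> i\<^sub>2 = 0\<close> follow from those
  below in a preadditive category.
\<close>

definition is_biproduct ::
    "('o, 'm) additive_data \<Rightarrow> 'o \<Rightarrow> 'o \<Rightarrow> 'o \<Rightarrow> 'm \<Rightarrow> 'm \<Rightarrow> 'm \<Rightarrow> 'm \<Rightarrow> bool" where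
  "is_biproduct A X Y P i\<^sub>1 i\<^sub>2 p\<^sub>1 p\<^sub>2 \<longleftrightarrow>
    i\<^sub>1 \<in> Hom A X P \<and> i\<^sub>2 \<in> Hom A Y P \<and> p\<^sub>1 \<in> Hom A P X \<and> p\<^sub>2 \<in> Hom A P Y \<and>
    p\<^sub>1 \<odot>\<^bsub>A\<^esub> i\<^sub>1 = Id A X \<and> p\<^sub>2 \<odot>\<^bsub>A\<^esub> i\<^sub>2 = Id A Y \<and>
    (i\<^sub>1 \<odot>\<^bsub>A\<^esub> p\<^sub>1) \<boxplus>\<^bsub>A\<^esub> (i\<^sub>2 \<odot>\<^bsub>A\<^esub> p\<^sub>2) = Id A P"

definition monic :: "('o, 'm) additive_data \<Rightarrow> 'm \<Rightarrow> bool" where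
  "monic A f \<longleftrightarrow> f \<in> Arr A \<and>
    (\<forall>X. \<forall>u \<in> Hom A X (Dom A f). \<forall>v \<in> Hom A X (Dom A f).
      f \<odot>\<^bsub>A\<^esub> u = f \<odot>\<^bsub>A\<^esub> v \<longrightarrow> u = v)"

definition epic :: "('o, 'm) additive_data \<Rightarrow> 'm \<Rightarrow> bool" where
  "epic A f \<longleftrightarrow> f \<in> Arr A \<and>
    (\<forall>X. \<forall>u \<in> Hom A (Cod A f) X. \<forall>v \<in> Hom A (Cod A f) X.
      u \<odot>\<^bsub>A\<^esub> f = v \<odot>\<^bsub>A\<^esub> f \<longrightarrow> u = v)"

definition isomorphism :: "('o, 'm) additive_data \<Rightarrow> 'm \<Rightarrow> bool" where
  "isomorphism A f \<longleftrightarrow> f \<in> Arr A \<and>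
    (\<exists>g \<in> Hom A (Cod A f) (Dom A f).
      g \<odot>\<^bsub>A\<^esub> f = Id A (Dom A f) \<and> f \<odot>\<^bsub>A\<^esub> g = Id A (Cod A f))"

definition isomorphic :: "('o, 'm) additive_data \<Rightarrow> 'o \<Rightarrow> 'o \<Rightarrow> bool" where
  "isomorphic A X Y \<longleftrightarrow> (\<exists>f \<in> Hom A X Y. isomorphism A f)"

definition is_kernel :: "('o, 'm) additive_data \<Rightarrow> 'm \<Rightarrow> 'm \<Rightarrow> bool" where
  "is_kernel A k f \<longleftrightarrow> f \<in> Arr A \<and> k \<in> Arr A \<and> Cod A k = Dom A f \<and>
    f \<odot>\<^bsub>A\<^esub> k = Zero A (Dom A k) (Cod A f) \<and>
    (\<forall>X. \<forall>h \<in> Hom A X (Dom A f). f \<odot>\<^bsub>A\<^esub> h = Zero A X (Cod A f) \<longrightarrow>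
      (\<exists>!u. u \<in> Hom A X (Dom A k) \<and> k \<odot>\<^bsub>A\<^esub> u = h))"

definition is_cokernel :: "('o, 'm) additive_data \<Rightarrow> 'm \<Rightarrow> 'm \<Rightarrow> bool" where
  "is_cokernel A c f \<longleftrightarrow> f \<in> Arr A \<and> c \<in> Arr A \<and> Dom A c = Cod A f \<and>
    c \<odot>\<^bsub>A\<^esub> f = Zero A (Dom A f) (Cod A c) \<and>
    (\<forall>X. \<forall>h \<in> Hom A (Cod A f) X. h \<odot>\<^bsub>A\<^esub> f = Zero A (Dom A f) X \<longrightarrow>
      (\<exists>!u. u \<in> Hom A (Cod A c) X \<and> u \<odot>\<^bsub>A\<^esub> c = h))"

text \<open>The inclusion of the image of \<open>f\<close> is a kernel of a cokernel of \<open>f\<close>.\<close>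

definition is_image :: "('o, 'm) additive_data \<Rightarrow> 'm \<Rightarrow> 'm \<Rightarrow> bool" where
  "is_image A i f \<longleftrightarrow> (\<exists>c. is_cokernel A c f \<and> is_kernel A i c)"

definition short_exact :: "('o, 'm) additive_data \<Rightarrow> 'm \<Rightarrow> 'm \<Rightarrow> bool" where
  "short_exact A f g \<longleftrightarrow> is_kernel A f g \<and> is_cokernel A g f"

locale abelian_category = preadditive_category +
  assumes ex_zero_object: "\<exists>Z. zero_object A Z"
    and ex_biproduct: "\<lbrakk>X \<in> Obj A; Y \<in> Obj A\<rbrakk>
      \<Longrightarrow> \<exists>P i\<^sub>1 i\<^sub>2 p\<^sub>1 p\<^sub>2. is_biproduct A X Y P i\<^sub>1 i\<^sub>2 p\<^sub>1 p\<^sub>2"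
    and ex_kernel: "f \<in> Arr A \<Longrightarrow> \<exists>k. is_kernel A k f"
    and ex_cokernel: "f \<in> Arr A \<Longrightarrow> \<exists>c. is_cokernel A c f"
    and monic_normal: "monic A f \<Longrightarrow> \<exists>g. is_kernel A f g"
    and epic_normal: "epic A f \<Longrightarrow> \<exists>g. is_cokernel A f g"

definition simple_object :: "('o, 'm) additive_data \<Rightarrow> 'o \<Rightarrow> bool" where
  "simple_object A S \<longleftrightarrow> S \<in> Obj A \<and> \<not> zero_object A S \<and>
    (\<forall>m. monic A m \<and> Cod A m = S \<longrightarrow> zero_object A (Dom A m) \<or> isomorphism A m)"

text \<open>
  A composition series \<open>0 = F 0 \<subseteq> F 1 \<subseteq> \<dots> \<subseteq> F n = M\<close> is given by the inclusions
  \<open>i k : F k \<rightarrow> F (k + 1)\<close>, each with a simple cokernel.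
\<close>

definition finite_length :: "('o, 'm) additive_data \<Rightarrow> 'o \<Rightarrow> bool" where
  "finite_length A M \<longleftrightarrow> (\<exists>(n::nat) F i. zero_object A (F 0) \<and> F n = M \<and>
    (\<forall>k<n. i k \<in> Hom A (F k) (F (Suc k)) \<and>
      (\<exists>p. short_exact A (i k) p \<and> simple_object A (Cod A p))))"

locale abelian_length_category = abelian_category +
  assumes all_finite_length: "M \<in> Obj A \<Longrightarrow> finite_length A M"

text \<open>
  A full subcategory is represented by its set of objects; \<open>full_subcategory A W\<close> is that
  subcategory as a category in its own right.
\<close>

definition subcategory :: "('o, 'm) additive_data \<Rightarrow> 'o set \<Rightarrow> bool" where
  "subcategory A C \<longleftrightarrow> C \<subseteq> Obj A \<and>
    (\<forall>X\<in>C. \<forall>Y\<in>Obj A. isomorphic A X Y \<longrightarrow> Y \<in> C) \<and> (\<exists>Z\<in>C. zero_object A Z)"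

definition full_subcategory ::
    "('o, 'm) additive_data \<Rightarrow> 'o set \<Rightarrow> ('o, 'm) additive_data" where
  "full_subcategory A W = A\<lparr>Obj := W, Arr := {f \<in> Arr A. Dom A f \<in> W \<and> Cod A f \<in> W}\<rparr>"

definition closed_under_extensions :: "('o, 'm) additive_data \<Rightarrow> 'o set \<Rightarrow> bool" where
  "closed_under_extensions A C \<longleftrightarrow>
    (\<forall>f g. short_exact A f g \<and> Dom A f \<in> C \<and> Cod A g \<in> C \<longrightarrow> Cod A f \<in> C)"

text \<open>
  Kernels, cokernels and images are determined up to isomorphism only, so closure is required
  for every choice of them.
\<close>

definition closed_under_kernels :: "('o, 'm) additive_data \<Rightarrow> 'o set \<Rightarrow> bool" where
  "closed_under_kernels A C \<longleftrightarrow>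
    (\<forall>X\<in>C. \<forall>Y\<in>C. \<forall>f \<in> Hom A X Y. \<forall>k. is_kernel A k f \<longrightarrow> Dom A k \<in> C)"

definition closed_under_cokernels :: "('o, 'm) additive_data \<Rightarrow> 'o set \<Rightarrow> bool" where
  "closed_under_cokernels A C \<longleftrightarrow>
    (\<forall>X\<in>C. \<forall>Y\<in>C. \<forall>f \<in> Hom A X Y. \<forall>c. is_cokernel A c f \<longrightarrow> Cod A c \<in> C)"

definition closed_under_images :: "('o, 'm) additive_data \<Rightarrow> 'o set \<Rightarrow> bool" where
  "closed_under_images A C \<longleftrightarrow>
    (\<forall>X\<in>C. \<forall>Y\<in>C. \<forall>f \<in> Hom A X Y. \<forall>i. is_image A i f \<longrightarrow> Dom A i \<in> C)"

definition closed_under_quotients :: "('o, 'm) additive_data \<Rightarrow> 'o set \<Rightarrow> bool" where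
  "closed_under_quotients A C \<longleftrightarrow> (\<forall>f. epic A f \<and> Dom A f \<in> C \<longrightarrow> Cod A f \<in> C)"

definition wide_subcategory :: "('o, 'm) additive_data \<Rightarrow> 'o set \<Rightarrow> bool" where
  "wide_subcategory A W \<longleftrightarrow> subcategory A W \<and> closed_under_extensions A W \<and>
    closed_under_kernels A W \<and> closed_under_cokernels A W"

definition ICE_closed_subcategory :: "('o, 'm) additive_data \<Rightarrow> 'o set \<Rightarrow> bool" where
  "ICE_closed_subcategory A C \<longleftrightarrow> subcategory A C \<and> closed_under_images A C \<and>
    closed_under_cokernels A C \<and> closed_under_extensions A C"

definition torsion_class :: "('o, 'm) additive_data \<Rightarrow> 'o set \<Rightarrow> bool" where
  "torsion_class B T \<longleftrightarrow> subcategory B T \<and> closed_under_extensions B T \<and>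
    closed_under_quotients B T"

end

theory Submission
  imports Defs
begin

text \<open>
  That a torsion class \<open>C\<close> in a wide subcategory \<open>W\<close> is ICE-closed is direct: images and
  cokernels of morphisms between objects of \<open>C\<close> lie in \<open>W\<close>, where they are quotients of objects
  of \<open>C\<close> (\<open>ICE_closed_if_torsion_class_in_wide\<close>).

  Conversely, let \<open>C\<close> be ICE-closed, let \<open>P\<close> be the class of objects without nonzero morphisms
  to \<open>C\<close>, and let \<open>F\<close> be the class of objects without nonzero morphisms from \<open>P\<close>. Then
  \<open>F\<close> contains \<open>C\<close> and is closed under subobjects and extensions. The wide subcategory is
  \<open>W = {X \<in> F. every morphism from X to an object of F has its cokernel in F}\<close>. Such a \<open>W\<close>
  is wide for every class \<open>F\<close> that is closed under subobjects and extensions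
  (\<open>wide_cokernel_stable\<close>); for kernels, a morphism out of a kernel is extended along a pushout
  without changing its cokernel.

  Both remaining claims, that \<open>C \<subseteq> W\<close> and that a quotient of an object of \<open>C\<close> lies in
  \<open>C\<close> as soon as it lies in \<open>F\<close>, rest on \<open>mem_if_cokernel_in_left_perp\<close>: an object \<open>E\<close> of
  \<open>F\<close> with a morphism \<open>X \<rightarrow> E\<close> from \<open>X \<in> C\<close> whose cokernel lies in \<open>P\<close> belongs to
  \<open>C\<close>. Every morphism \<open>h\<close> from \<open>E\<close> to \<open>C\<close> has its image in \<open>C\<close>, because \<open>h\<close> has
  the same cokernel as its composite with \<open>X \<rightarrow> E\<close>. Choose \<open>h\<close> with a kernel \<open>K\<close> of
  least length. Given \<open>g : K \<rightarrow> Y\<close> with \<open>Y \<in> C\<close>, the pushout of \<open>K \<rightarrow> E\<close> along \<open>g\<close>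
  is an extension of the image of \<open>h\<close> by \<open>Y\<close>, hence lies in \<open>C\<close>; a nonzero \<open>g\<close> would make
  the kernel of the map from \<open>E\<close> to the pushout shorter than \<open>K\<close>. So \<open>K\<close> lies in \<open>P\<close>, its
  inclusion into \<open>E \<in> F\<close> is zero, \<open>h\<close> is monic, and \<open>E\<close> is the image of \<open>h\<close>. The quotient
  claim is the case of a zero cokernel. For \<open>C \<subseteq> W\<close>, a subobject \<open>V \<in> P\<close> of the cokernel
  of \<open>X \<rightarrow> Y\<close> has a preimage \<open>E\<close> in \<open>Y\<close>, and \<open>X \<rightarrow> E\<close> has cokernel \<open>V\<close>; thus
  \<open>E\<close> and \<open>V\<close> lie in \<open>C\<close>, which forces \<open>V = 0\<close>.
\<close>

section \<open>Preadditive categories\<close>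

lemma HomD:
  assumes "f \<in> Hom A X Y"
  shows "f \<in> Arr A" "Dom A f = X" "Cod A f = Y"
  using assms by (auto simp: Hom_def)

lemma Arr_HomI: "f \<in> Arr A \<Longrightarrow> f \<in> Hom A (Dom A f) (Cod A f)"
  by (simp add: Hom_def)

lemma (in category) Hom_Obj:
  assumes "f \<in> Hom A X Y"
  shows "X \<in> Obj A" "Y \<in> Obj A"
  using assms Dom_closed Cod_closed by (auto simp: Hom_def)

context preadditive_category
begin

lemma Zero_closed: "X \<in> Obj A \<Longrightarrow> Y \<in> Obj A \<Longrightarrow> Zero A X Y \<in> Hom A X Y"
  using comm_group.axioms(2)[OF hom_comm_group, THEN group.is_monoid, THEN monoid.one_closed]
  by (simp add: hom_group_def)

lemma Add_closed:
  assumes "f \<in> Hom A X Y" "g \<in> Hom A X Y"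
  shows "f \<boxplus> g \<in> Hom A X Y"
proof -
  interpret comm_group "hom_group A X Y"
    using assms Hom_Obj hom_comm_group by blast
  show ?thesis using m_closed assms by (simp add: hom_group_def)
qed

lemma Add_Zero:
  assumes "f \<in> Hom A X Y"
  shows "f \<boxplus> Zero A X Y = f" "Zero A X Y \<boxplus> f = f"
proof -
  interpret comm_group "hom_group A X Y"
    using assms Hom_Obj hom_comm_group by blast
  show "f \<boxplus> Zero A X Y = f" "Zero A X Y \<boxplus> f = f"
    using r_one l_one assms by (simp_all add: hom_group_def)
qed

lemma Add_right_cancel:
  assumes "f \<in> Hom A X Y" "g \<in> Hom A X Y" "h \<in> Hom A X Y" "f \<boxplus> h = g \<boxplus> h"
  shows "f = g"
proof -
  interpret comm_group "hom_group A X Y"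
    using assms Hom_Obj hom_comm_group by blast
  show ?thesis using right_cancel[of h f g] assms by (simp add: hom_group_def)
qed

lemma Add_left_cancel:
  assumes "f \<in> Hom A X Y" "g \<in> Hom A X Y" "h \<in> Hom A X Y" "h \<boxplus> f = h \<boxplus> g"
  shows "f = g"
proof -
  interpret comm_group "hom_group A X Y"
    using assms Hom_Obj hom_comm_group by blast
  show ?thesis using Units_l_cancel[of h f g] Units_eq assms by (simp add: hom_group_def)
qed

lemma ex_negative:
  assumes "f \<in> Hom A X Y"
  obtains f' where "f' \<in> Hom A X Y" "f \<boxplus> f' = Zero A X Y"
proof -
  interpret comm_group "hom_group A X Y"
    using assms Hom_Obj hom_comm_group by blast
  show ?thesis using r_inv_ex[of f] assms that by (auto simp: hom_group_def)
qed

lemma Comp_Zero_right: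
  assumes g: "g \<in> Hom A Y Z" and X: "X \<in> Obj A"
  shows "g \<odot> Zero A X Y = Zero A X Z"
proof -
  have z: "Zero A X Y \<in> Hom A X Y" using Zero_closed Hom_Obj[OF g] X by blast
  have c: "g \<odot> Zero A X Y \<in> Hom A X Z" using Comp_closed[OF z g] .
  have "g \<odot> (Zero A X Y \<boxplus> Zero A X Y) = g \<odot> Zero A X Y \<boxplus> g \<odot> Zero A X Y"
    by (rule Comp_Add_right[OF z z g])
  then have "g \<odot> Zero A X Y \<boxplus> Zero A X Z = g \<odot> Zero A X Y \<boxplus> g \<odot> Zero A X Y"
    using Add_Zero(1)[OF z] Add_Zero(1)[OF c] by simp
  then show ?thesis
    using Add_left_cancel[OF _ c c] Zero_closed Hom_Obj[OF g] X by metis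
qed

lemma Comp_Zero_left:
  assumes f: "f \<in> Hom A X Y" and Z: "Z \<in> Obj A"
  shows "Zero A Y Z \<odot> f = Zero A X Z"
proof -
  have z: "Zero A Y Z \<in> Hom A Y Z" using Zero_closed Hom_Obj[OF f] Z by blast
  have c: "Zero A Y Z \<odot> f \<in> Hom A X Z" using Comp_closed[OF f z] .
  have "(Zero A Y Z \<boxplus> Zero A Y Z) \<odot> f = Zero A Y Z \<odot> f \<boxplus> Zero A Y Z \<odot> f"
    by (rule Comp_Add_left[OF f z z])
  then have "Zero A Y Z \<odot> f \<boxplus> Zero A X Z = Zero A Y Z \<odot> f \<boxplus> Zero A Y Z \<odot> f"
    using Add_Zero(1)[OF z] Add_Zero(1)[OF c] by simp
  then show ?thesis
    using Add_left_cancel[OF _ c c] Zero_closed Hom_Obj[OF f] Z by metis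
qed

section \<open>Monic and epic arrows\<close>

lemma monicI:
  assumes f: "f \<in> Hom A X Y"
    and 0: "\<And>T u. u \<in> Hom A T X \<Longrightarrow> f \<odot> u = Zero A T Y \<Longrightarrow> u = Zero A T X"
  shows "monic A f"
  unfolding monic_def HomD[OF f]
proof (intro conjI allI ballI impI)
  show "f \<in> Arr A" using HomD[OF f] by blast
  fix T u v assume u: "u \<in> Hom A T X" and v: "v \<in> Hom A T X" and eq: "f \<odot> u = f \<odot> v"
  obtain v' where v': "v' \<in> Hom A T X" "v \<boxplus> v' = Zero A T X" using ex_negative[OF v] .
  have "f \<odot> (u \<boxplus> v') = f \<odot> (v \<boxplus> v')"
    using Comp_Add_right[OF u v'(1) f] Comp_Add_right[OF v v'(1) f] eq by simp
  then have "f \<odot> (u \<boxplus> v') = Zero A T Y"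
    using v'(2) Comp_Zero_right[OF f] Hom_Obj[OF u] by simp
  then have "u \<boxplus> v' = v \<boxplus> v'" using 0[OF Add_closed[OF u v'(1)]] v'(2) by simp
  then show "u = v" using Add_right_cancel[OF u v v'(1)] by blast
qed

lemma epicI:
  assumes f: "f \<in> Hom A X Y"
    and 0: "\<And>T u. u \<in> Hom A Y T \<Longrightarrow> u \<odot> f = Zero A X T \<Longrightarrow> u = Zero A Y T"
  shows "epic A f"
  unfolding epic_def HomD[OF f]
proof (intro conjI allI ballI impI)
  show "f \<in> Arr A" using HomD[OF f] by blast
  fix T u v assume u: "u \<in> Hom A Y T" and v: "v \<in> Hom A Y T" and eq: "u \<odot> f = v \<odot> f"
  obtain v' where v': "v' \<in> Hom A Y T" "v \<boxplus> v' = Zero A Y T" using ex_negative[OF v] .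
  have "(u \<boxplus> v') \<odot> f = (v \<boxplus> v') \<odot> f"
    using Comp_Add_left[OF f u v'(1)] Comp_Add_left[OF f v v'(1)] eq by simp
  then have "(u \<boxplus> v') \<odot> f = Zero A X T"
    using v'(2) Comp_Zero_left[OF f] Hom_Obj[OF u] by simp
  then have "u \<boxplus> v' = v \<boxplus> v'" using 0[OF Add_closed[OF u v'(1)]] v'(2) by simp
  then show "u = v" using Add_right_cancel[OF u v v'(1)] by blast
qed

lemma monic_cancel:
  assumes "monic A f" "f \<in> Hom A X Y" "u \<in> Hom A T X" "v \<in> Hom A T X" "f \<odot> u = f \<odot> v"
  shows "u = v"
  using assms by (auto simp: monic_def HomD)

lemma epic_cancel:
  assumes "epic A f" "f \<in> Hom A X Y" "u \<in> Hom A Y T" "v \<in> Hom A Y T" "u \<odot> f = v \<odot> f"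
  shows "u = v"
  using assms by (auto simp: epic_def HomD)

lemma monic_cancel_Zero:
  assumes "monic A f" "f \<in> Hom A X Y" "u \<in> Hom A T X" "f \<odot> u = Zero A T Y"
  shows "u = Zero A T X"
  using monic_cancel[OF assms(1-3)] assms Zero_closed Hom_Obj Comp_Zero_right by metis

lemma epic_cancel_Zero:
  assumes "epic A f" "f \<in> Hom A X Y" "u \<in> Hom A Y T" "u \<odot> f = Zero A X T"
  shows "u = Zero A Y T"
  using epic_cancel[OF assms(1-3)] assms Zero_closed Hom_Obj Comp_Zero_left by metis

lemma monic_Comp:
  assumes m: "monic A f" "f \<in> Hom A X Y" and n: "monic A g" "g \<in> Hom A Y Z"
  shows "monic A (g \<odot> f)"
proof (rule monicI[OF Comp_closed[OF m(2) n(2)]])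
  fix T u assume u: "u \<in> Hom A T X" and "g \<odot> f \<odot> u = Zero A T Z"
  then have "g \<odot> (f \<odot> u) = Zero A T Z" using Comp_assoc[OF u m(2) n(2)] by simp
  then have "f \<odot> u = Zero A T Y" using monic_cancel_Zero[OF n Comp_closed[OF u m(2)]] by blast
  then show "u = Zero A T X" using monic_cancel_Zero[OF m u] by blast
qed

lemma epic_Comp:
  assumes m: "epic A f" "f \<in> Hom A X Y" and n: "epic A g" "g \<in> Hom A Y Z"
  shows "epic A (g \<odot> f)"
proof (rule epicI[OF Comp_closed[OF m(2) n(2)]])
  fix T u assume u: "u \<in> Hom A Z T" and "u \<odot> (g \<odot> f) = Zero A X T"
  then have "u \<odot> g \<odot> f = Zero A X T" using Comp_assoc[OF m(2) n(2) u] by simp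
  then have "u \<odot> g = Zero A Y T" using epic_cancel_Zero[OF m Comp_closed[OF n(2) u]] by blast
  then show "u = Zero A Z T" using epic_cancel_Zero[OF n u] by blast
qed

lemma monic_right_factor:
  assumes f: "f \<in> Hom A X Y" and g: "g \<in> Hom A Y Z" and m: "monic A (g \<odot> f)"
  shows "monic A f"
proof (rule monicI[OF f])
  fix T u assume u: "u \<in> Hom A T X" and "f \<odot> u = Zero A T Y"
  then have "g \<odot> f \<odot> u = Zero A T Z"
    using Comp_assoc[OF u f g] Comp_Zero_right[OF g] Hom_Obj[OF u] by simp
  then show "u = Zero A T X" using monic_cancel_Zero[OF m Comp_closed[OF f g] u] by blast
qed

lemma epic_left_factor:
  assumes f: "f \<in> Hom A X Y" and g: "g \<in> Hom A Y Z" and e: "epic A (g \<odot> f)"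
  shows "epic A g"
proof (rule epicI[OF g])
  fix T u assume u: "u \<in> Hom A Z T" and "u \<odot> g = Zero A Y T"
  then have "u \<odot> (g \<odot> f) = Zero A X T"
    using Comp_assoc[OF f g u] Comp_Zero_left[OF f] Hom_Obj[OF u] by simp
  then show "u = Zero A Z T" using epic_cancel_Zero[OF e Comp_closed[OF f g] u] by blast
qed

lemma isomorphismI:
  assumes "f \<in> Hom A X Y" "g \<in> Hom A Y X" "g \<odot> f = Id A X" "f \<odot> g = Id A Y"
  shows "isomorphism A f"
  unfolding isomorphism_def using assms by (auto simp: HomD)

lemma isomorphismE:
  assumes "isomorphism A f" "f \<in> Hom A X Y"
  obtains g where "g \<in> Hom A Y X" "g \<odot> f = Id A X" "f \<odot> g = Id A Y"
  using assms unfolding isomorphism_def by (auto simp: HomD)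

lemma monic_Id: "X \<in> Obj A \<Longrightarrow> monic A (Id A X)"
  by (rule monicI[OF Id_closed]) (auto simp: Comp_Id_left)

lemma epic_Id: "X \<in> Obj A \<Longrightarrow> epic A (Id A X)"
  by (rule epicI[OF Id_closed]) (auto simp: Comp_Id_right)

lemma isomorphism_monic:
  assumes "isomorphism A f" "f \<in> Hom A X Y"
  shows "monic A f"
  using isomorphismE[OF assms] monic_right_factor assms(2) monic_Id Hom_Obj by metis

lemma isomorphism_epic:
  assumes "isomorphism A f" "f \<in> Hom A X Y"
  shows "epic A f"
  using isomorphismE[OF assms] epic_left_factor assms(2) epic_Id Hom_Obj by metis

section \<open>Kernels and cokernels\<close>

lemma kernelI:
  assumes f: "f \<in> Hom A X Y" and k: "k \<in> Hom A K X" "monic A k" "f \<odot> k = Zero A K Y"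
    and univ: "\<And>T h. h \<in> Hom A T X \<Longrightarrow> f \<odot> h = Zero A T Y \<Longrightarrow> \<exists>u \<in> Hom A T K. k \<odot> u = h"
  shows "is_kernel A k f"
  unfolding is_kernel_def HomD[OF f] HomD[OF k(1)]
  using HomD(1)[OF f] HomD(1)[OF k(1)] k(3) univ monic_cancel[OF k(2,1)] by metis

lemma cokernelI:
  assumes f: "f \<in> Hom A X Y" and c: "c \<in> Hom A Y Q" "epic A c" "c \<odot> f = Zero A X Q"
    and univ: "\<And>T h. h \<in> Hom A Y T \<Longrightarrow> h \<odot> f = Zero A X T \<Longrightarrow> \<exists>u \<in> Hom A Q T. u \<odot> c = h"
  shows "is_cokernel A c f"
  unfolding is_cokernel_def HomD[OF f] HomD[OF c(1)]
  using HomD(1)[OF f] HomD(1)[OF c(1)] c(3) univ epic_cancel[OF c(2,1)] by metis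

lemma kernelD:
  assumes k: "is_kernel A k f" and f: "f \<in> Hom A X Y"
  shows "k \<in> Hom A (Dom A k) X" "f \<odot> k = Zero A (Dom A k) Y" "monic A k"
proof -
  show kH: "k \<in> Hom A (Dom A k) X" and 0: "f \<odot> k = Zero A (Dom A k) Y"
    using k f unfolding is_kernel_def by (auto simp: Hom_def)
  show "monic A k"
  proof (rule monicI[OF kH])
    fix T u assume u: "u \<in> Hom A T (Dom A k)" and ku: "k \<odot> u = Zero A T X"
    have T: "T \<in> Obj A" "X \<in> Obj A" "Dom A k \<in> Obj A"
      using Hom_Obj[OF u] Hom_Obj[OF kH] by auto
    have z: "Zero A T X \<in> Hom A T (Dom A f)" using Zero_closed T HomD[OF f] by simp
    have "f \<odot> Zero A T X = Zero A T (Cod A f)" using Comp_Zero_right[OF f] T HomD[OF f] by simp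
    then have "\<exists>!u. u \<in> Hom A T (Dom A k) \<and> k \<odot> u = Zero A T X"
      using k z unfolding is_kernel_def by blast
    then show "u = Zero A T (Dom A k)"
      using u ku Zero_closed T Comp_Zero_right[OF kH] by metis
  qed
qed

lemma cokernelD:
  assumes c: "is_cokernel A c f" and f: "f \<in> Hom A X Y"
  shows "c \<in> Hom A Y (Cod A c)" "c \<odot> f = Zero A X (Cod A c)" "epic A c"
proof -
  show cH: "c \<in> Hom A Y (Cod A c)" and 0: "c \<odot> f = Zero A X (Cod A c)"
    using c f unfolding is_cokernel_def by (auto simp: Hom_def)
  show "epic A c"
  proof (rule epicI[OF cH])
    fix T u assume u: "u \<in> Hom A (Cod A c) T" and uc: "u \<odot> c = Zero A Y T"
    have T: "T \<in> Obj A" "Y \<in> Obj A" "Cod A c \<in> Obj A"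
      using Hom_Obj[OF u] Hom_Obj[OF cH] by auto
    have z: "Zero A Y T \<in> Hom A (Cod A f) T" using Zero_closed T HomD[OF f] by simp
    have "Zero A Y T \<odot> f = Zero A (Dom A f) T" using Comp_Zero_left[OF f] T HomD[OF f] by simp
    then have "\<exists>!u. u \<in> Hom A (Cod A c) T \<and> u \<odot> c = Zero A Y T"
      using c z unfolding is_cokernel_def by blast
    then show "u = Zero A (Cod A c) T"
      using u uc Zero_closed T Comp_Zero_left[OF cH] by metis
  qed
qed

lemma kernel_factor:
  assumes k: "is_kernel A k f" and f: "f \<in> Hom A X Y"
    and h: "h \<in> Hom A T X" "f \<odot> h = Zero A T Y"
  obtains u where "u \<in> Hom A T (Dom A k)" "k \<odot> u = h"
  using k h unfolding is_kernel_def HomD[OF f] by metis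

lemma cokernel_factor:
  assumes c: "is_cokernel A c f" and f: "f \<in> Hom A X Y"
    and h: "h \<in> Hom A Y T" "h \<odot> f = Zero A X T"
  obtains u where "u \<in> Hom A (Cod A c) T" "u \<odot> c = h"
  using c h unfolding is_cokernel_def HomD[OF f] by metis

lemma kernel_Hom: "is_kernel A k f \<Longrightarrow> f \<in> Hom A (Cod A k) (Cod A f)"
  "is_kernel A k f \<Longrightarrow> k \<in> Hom A (Dom A k) (Cod A k)"
  unfolding is_kernel_def Hom_def by auto

lemma cokernel_Hom: "is_cokernel A c f \<Longrightarrow> f \<in> Hom A (Dom A f) (Dom A c)"
  "is_cokernel A c f \<Longrightarrow> c \<in> Hom A (Dom A c) (Cod A c)"
  unfolding is_cokernel_def Hom_def by auto

lemma cokernel_Comp_epic: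
  assumes c: "is_cokernel A c f" and f: "f \<in> Hom A X Y" and q: "epic A q" "q \<in> Hom A T X"
  shows "is_cokernel A c (f \<odot> q)"
proof -
  note cD = cokernelD[OF c f]
  have fq: "f \<odot> q \<in> Hom A T Y" using Comp_closed[OF q(2) f] .
  show ?thesis
  proof (rule cokernelI[OF fq cD(1,3)])
    show "c \<odot> (f \<odot> q) = Zero A T (Cod A c)"
      using Comp_assoc[OF q(2) f cD(1)] cD(2) Comp_Zero_left[OF q(2)] Hom_Obj[OF cD(1)] by simp
    fix S h assume h: "h \<in> Hom A Y S" "h \<odot> (f \<odot> q) = Zero A T S"
    have "h \<odot> f \<odot> q = Zero A T S" using Comp_assoc[OF q(2) f h(1)] h(2) by simp
    then have "h \<odot> f = Zero A X S" using epic_cancel_Zero[OF q Comp_closed[OF f h(1)]] by blast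
    then show "\<exists>u\<in>Hom A (Cod A c) S. u \<odot> c = h" using cokernel_factor[OF c f h(1)] by metis
  qed
qed

lemma kernel_Comp_isomorphism:
  assumes k: "is_kernel A k f" and u: "u \<in> Hom A T (Dom A k)" "isomorphism A u"
  shows "is_kernel A (k \<odot> u) f"
proof -
  have f: "f \<in> Hom A (Cod A k) (Cod A f)" using kernel_Hom[OF k] by blast
  note kD = kernelD[OF k f]
  obtain v where v: "v \<in> Hom A (Dom A k) T" "u \<odot> v = Id A (Dom A k)"
    using isomorphismE[OF u(2,1)] by metis
  have ku: "k \<odot> u \<in> Hom A T (Cod A k)" using Comp_closed[OF u(1) kD(1)] .
  show ?thesis
  proof (rule kernelI[OF f ku monic_Comp[OF isomorphism_monic[OF u(2,1)] u(1) kD(3,1)]])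
    show "f \<odot> (k \<odot> u) = Zero A T (Cod A f)"
      using Comp_assoc[OF u(1) kD(1) f] kD(2) Comp_Zero_left[OF u(1)] Hom_Obj[OF f] by simp
    fix S h assume h: "h \<in> Hom A S (Cod A k)" "f \<odot> h = Zero A S (Cod A f)"
    obtain w where w: "w \<in> Hom A S (Dom A k)" "k \<odot> w = h" using kernel_factor[OF k f h] .
    have "k \<odot> u \<odot> (v \<odot> w) = k \<odot> (u \<odot> v \<odot> w)"
      using Comp_assoc[OF Comp_closed[OF w(1) v(1)] u(1) kD(1)] Comp_assoc[OF w(1) v(1) u(1)] by simp
    also have "\<dots> = h" using v(2) w Comp_Id_left[OF w(1)] by simp
    finally show "\<exists>w\<in>Hom A S T. k \<odot> u \<odot> w = h" using Comp_closed[OF w(1) v(1)] by blast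
  qed
qed

lemma cokernel_Comp_isomorphism:
  assumes c: "is_cokernel A c f" and u: "u \<in> Hom A (Cod A c) T" "isomorphism A u"
  shows "is_cokernel A (u \<odot> c) f"
proof -
  have f: "f \<in> Hom A (Dom A f) (Dom A c)" using cokernel_Hom[OF c] by blast
  note cD = cokernelD[OF c f]
  obtain v where v: "v \<in> Hom A T (Cod A c)" "v \<odot> u = Id A (Cod A c)"
    using isomorphismE[OF u(2,1)] by metis
  have uc: "u \<odot> c \<in> Hom A (Dom A c) T" using Comp_closed[OF cD(1) u(1)] .
  show ?thesis
  proof (rule cokernelI[OF f uc epic_Comp[OF cD(3,1) isomorphism_epic[OF u(2,1)] u(1)]])
    show "u \<odot> c \<odot> f = Zero A (Dom A f) T"
      using Comp_assoc[OF f cD(1) u(1)] cD(2) Comp_Zero_right[OF u(1)] Hom_Obj[OF f] by simp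
    fix S h assume h: "h \<in> Hom A (Dom A c) S" "h \<odot> f = Zero A (Dom A f) S"
    obtain w where w: "w \<in> Hom A (Cod A c) S" "w \<odot> c = h" using cokernel_factor[OF c f h] .
    have "w \<odot> v \<odot> (u \<odot> c) = w \<odot> (v \<odot> u) \<odot> c"
      using Comp_assoc[OF cD(1) u(1) Comp_closed[OF v(1) w(1)]] Comp_assoc[OF u(1) v(1) w(1)] by simp
    also have "\<dots> = h" using v(2) w Comp_Id_right[OF w(1)] by simp
    finally show "\<exists>w\<in>Hom A T S. w \<odot> (u \<odot> c) = h" using Comp_closed[OF v(1) w(1)] by blast
  qed
qed

end

section \<open>Images and pushouts in abelian categories\<close>

context abelian_category
begin

lemma monic_kernel_of_cokernel:
  assumes m: "monic A m" "m \<in> Hom A X Y" and c: "is_cokernel A c m"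
  shows "is_kernel A m c"
proof -
  note cD = cokernelD[OF c m(2)]
  obtain g where g: "is_kernel A m g" using monic_normal[OF m(1)] by blast
  have gH: "g \<in> Hom A Y (Cod A g)" using kernel_Hom[OF g] HomD[OF m(2)] by simp
  have gm: "g \<odot> m = Zero A X (Cod A g)" using kernelD(2)[OF g gH] HomD[OF m(2)] by simp
  obtain w where w: "w \<in> Hom A (Cod A c) (Cod A g)" "w \<odot> c = g"
    using cokernel_factor[OF c m(2) gH gm] .
  show ?thesis
  proof (rule kernelI[OF cD(1) m(2,1) cD(2)])
    fix T h assume h: "h \<in> Hom A T Y" "c \<odot> h = Zero A T (Cod A c)"
    have "g \<odot> h = Zero A T (Cod A g)"
      using w Comp_assoc[OF h(1) cD(1) w(1)] h(2) Comp_Zero_right[OF w(1)] Hom_Obj[OF h(1)] by simp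
    then show "\<exists>u\<in>Hom A T X. m \<odot> u = h"
      using kernel_factor[OF g gH h(1)] HomD[OF m(2)] by metis
  qed
qed

lemma epic_cokernel_of_kernel:
  assumes e: "epic A e" "e \<in> Hom A X Y" and k: "is_kernel A k e"
  shows "is_cokernel A e k"
proof -
  note kD = kernelD[OF k e(2)]
  obtain g where g: "is_cokernel A e g" using epic_normal[OF e(1)] by blast
  have gH: "g \<in> Hom A (Dom A g) X" using cokernel_Hom[OF g] HomD[OF e(2)] by simp
  have eg: "e \<odot> g = Zero A (Dom A g) Y" using cokernelD(2)[OF g gH] HomD[OF e(2)] by simp
  obtain w where w: "w \<in> Hom A (Dom A g) (Dom A k)" "k \<odot> w = g"
    using kernel_factor[OF k e(2) gH eg] .
  show ?thesis
  proof (rule cokernelI[OF kD(1) e(2,1) kD(2)])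
    fix T h assume h: "h \<in> Hom A X T" "h \<odot> k = Zero A (Dom A k) T"
    have "h \<odot> g = Zero A (Dom A g) T"
      using w Comp_assoc[OF w(1) kD(1) h(1)] h(2) Comp_Zero_left[OF w(1)] Hom_Obj[OF h(1)] by simp
    then show "\<exists>u\<in>Hom A Y T. u \<odot> e = h"
      using cokernel_factor[OF g gH h(1)] HomD[OF e(2)] by metis
  qed
qed

lemma monic_epic_isomorphism:
  assumes m: "monic A m" "m \<in> Hom A X Y" and e: "epic A m"
  shows "isomorphism A m"
proof -
  obtain g where g: "is_kernel A m g" using monic_normal[OF m(1)] by blast
  have gH: "g \<in> Hom A Y (Cod A g)" using kernel_Hom[OF g] HomD[OF m(2)] by simp
  have gm: "g \<odot> m = Zero A X (Cod A g)" using kernelD(2)[OF g gH] HomD[OF m(2)] by simp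
  have Y: "Y \<in> Obj A" "X \<in> Obj A" using Hom_Obj[OF m(2)] by auto
  have "g = Zero A Y (Cod A g)" using epic_cancel_Zero[OF e m(2) gH gm] .
  then have "g \<odot> Id A Y = Zero A Y (Cod A g)" using Comp_Id_right[OF gH] by simp
  then obtain s where s: "s \<in> Hom A Y X" "m \<odot> s = Id A Y"
    using kernel_factor[OF g gH Id_closed[OF Y(1)]] HomD[OF m(2)] by metis
  have "m \<odot> (s \<odot> m) = m \<odot> Id A X"
    using Comp_assoc[OF m(2) s(1) m(2)] s(2) Comp_Id_left[OF m(2)] Comp_Id_right[OF m(2)] by simp
  then have "s \<odot> m = Id A X"
    using monic_cancel[OF m Comp_closed[OF m(2) s(1)] Id_closed[OF Y(2)]] by blast
  then show ?thesis using isomorphismI[OF m(2) s(1)] s(2) by blast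
qed

text \<open>
  That \<open>e\<close> is epic: if \<open>w\<close> kills \<open>e\<close>, then \<open>f\<close> already factors through the smaller
  subobject \<open>i \<odot> ker w\<close>. Being the kernel of some \<open>g\<close>, this subobject contains everything that
  the cokernel of \<open>f\<close> kills, in particular \<open>i\<close>, so \<open>ker w\<close> has a right inverse and
  \<open>w = 0\<close>.
\<close>

lemma image_factorization:
  assumes f: "f \<in> Hom A X Y" and i: "is_image A i f"
  obtains e where "e \<in> Hom A X (Dom A i)" "epic A e" "i \<odot> e = f"
    "i \<in> Hom A (Dom A i) Y" "monic A i"
proof -
  obtain c where c: "is_cokernel A c f" and ic: "is_kernel A i c"
    using i unfolding is_image_def by blast
  note cD = cokernelD[OF c f]
  note iD = kernelD[OF ic cD(1)]
  let ?I = "Dom A i"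
  obtain e where e: "e \<in> Hom A X ?I" "i \<odot> e = f" using kernel_factor[OF ic cD(1) f cD(2)] .
  have "epic A e"
  proof (rule epicI[OF e(1)])
    fix T w assume w: "w \<in> Hom A ?I T" "w \<odot> e = Zero A X T"
    obtain k where k: "is_kernel A k w" using ex_kernel HomD[OF w(1)] by blast
    note kD = kernelD[OF k w(1)]
    obtain e' where e': "e' \<in> Hom A X (Dom A k)" "k \<odot> e' = e"
      using kernel_factor[OF k w(1) e(1) w(2)] .
    have ik: "i \<odot> k \<in> Hom A (Dom A k) Y" using Comp_closed[OF kD(1) iD(1)] .
    have "monic A (i \<odot> k)" using monic_Comp[OF kD(3,1) iD(3,1)] .
    then obtain g where g: "is_kernel A (i \<odot> k) g" using monic_normal by blast
    have gH: "g \<in> Hom A Y (Cod A g)" using kernel_Hom[OF g] HomD[OF ik] by simp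
    have gik: "g \<odot> (i \<odot> k) = Zero A (Dom A k) (Cod A g)"
      using kernelD(2)[OF g gH] HomD[OF ik] by simp
    have "i \<odot> k \<odot> e' = f" using Comp_assoc[OF e'(1) kD(1) iD(1)] e'(2) e(2) by simp
    then have "g \<odot> f = g \<odot> (i \<odot> k) \<odot> e'" using Comp_assoc[OF e'(1) ik gH] by simp
    then have "g \<odot> f = Zero A X (Cod A g)"
      using gik Comp_Zero_left[OF e'(1)] Hom_Obj[OF gH] by simp
    then obtain g' where g': "g' \<in> Hom A (Cod A c) (Cod A g)" "g' \<odot> c = g"
      using cokernel_factor[OF c f gH] by blast
    have "g \<odot> i = Zero A ?I (Cod A g)"
      using Comp_assoc[OF iD(1) cD(1) g'(1)] g'(2) iD(2) Comp_Zero_right[OF g'(1)]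
        Hom_Obj[OF iD(1)] by simp
    then obtain s where s: "s \<in> Hom A ?I (Dom A k)" "i \<odot> k \<odot> s = i"
      using kernel_factor[OF g gH iD(1)] HomD[OF ik] by metis
    have "i \<odot> (k \<odot> s) = i \<odot> Id A ?I"
      using Comp_assoc[OF s(1) kD(1) iD(1)] s(2) Comp_Id_right[OF iD(1)] by simp
    then have "k \<odot> s = Id A ?I"
      using monic_cancel[OF iD(3,1) Comp_closed[OF s(1) kD(1)] Id_closed] Hom_Obj[OF iD(1)] by blast
    then have "w = w \<odot> k \<odot> s"
      using Comp_assoc[OF s(1) kD(1) w(1)] Comp_Id_right[OF w(1)] by simp
    then show "w = Zero A ?I T"
      using kD(2) Comp_Zero_left[OF s(1)] Hom_Obj[OF w(1)] by simp
  qed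
  then show thesis using that e iD by blast
qed

lemma ex_image:
  assumes "f \<in> Hom A X Y"
  obtains i where "is_image A i f"
  using ex_cokernel[of f] ex_kernel HomD[OF assms] unfolding is_image_def is_cokernel_def by metis

text \<open>
  Uniqueness of the induced morphism is stated as joint right-cancellability of \<open>a\<close> and \<open>b\<close>,
  the form in which it is applied.
\<close>

definition pushout :: "'a \<Rightarrow> 'a \<Rightarrow> 'a \<Rightarrow> 'a \<Rightarrow> 'b \<Rightarrow> 'b \<Rightarrow> 'b \<Rightarrow> 'b \<Rightarrow> bool" where
  "pushout K X Y P f g a b \<longleftrightarrow>
    f \<in> Hom A K X \<and> g \<in> Hom A K Y \<and> a \<in> Hom A X P \<and> b \<in> Hom A Y P \<and> a \<odot> f = b \<odot> g \<and>
    (\<forall>T. \<forall>\<alpha> \<in> Hom A X T. \<forall>\<beta> \<in> Hom A Y T. \<alpha> \<odot> f = \<beta> \<odot> g \<longrightarrow>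
      (\<exists>w \<in> Hom A P T. w \<odot> a = \<alpha> \<and> w \<odot> b = \<beta>)) \<and>
    (\<forall>T. \<forall>w \<in> Hom A P T. \<forall>w' \<in> Hom A P T. w \<odot> a = w' \<odot> a \<and> w \<odot> b = w' \<odot> b \<longrightarrow> w = w')"

lemma pushout_swap: "pushout K X Y P f g a b \<Longrightarrow> pushout K Y X P g f b a"
  unfolding pushout_def by metis

text \<open>
  Parallel sides of a pushout square have the same cokernel: \<open>p\<close> is induced by \<open>c\<close> and the zero
  morphism.
\<close>

lemma pushout_cokernel:
  assumes po: "pushout K X Y P f g a b" and c: "is_cokernel A c f"
  obtains p where "p \<in> Hom A P (Cod A c)" "p \<odot> a = c" "is_cokernel A p b"
proof -
  have f: "f \<in> Hom A K X" and g: "g \<in> Hom A K Y" and a: "a \<in> Hom A X P" and b: "b \<in> Hom A Y P"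
    and comm: "a \<odot> f = b \<odot> g"
    and univ: "\<And>T \<alpha> \<beta>. \<alpha> \<in> Hom A X T \<Longrightarrow> \<beta> \<in> Hom A Y T \<Longrightarrow> \<alpha> \<odot> f = \<beta> \<odot> g \<Longrightarrow>
      (\<exists>w \<in> Hom A P T. w \<odot> a = \<alpha> \<and> w \<odot> b = \<beta>)"
    and joint: "\<And>T w w'. w \<in> Hom A P T \<Longrightarrow> w' \<in> Hom A P T \<Longrightarrow> w \<odot> a = w' \<odot> a \<Longrightarrow>
      w \<odot> b = w' \<odot> b \<Longrightarrow> w = w'"
    using po unfolding pushout_def by blast+
  note cD = cokernelD[OF c f]
  have obj: "Cod A c \<in> Obj A" "Y \<in> Obj A" using Hom_Obj cD b by blast+
  have z: "Zero A Y (Cod A c) \<in> Hom A Y (Cod A c)" using Zero_closed obj by blast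
  have "c \<odot> f = Zero A Y (Cod A c) \<odot> g" using cD(2) Comp_Zero_left[OF g] obj by simp
  then obtain p where p: "p \<in> Hom A P (Cod A c)" "p \<odot> a = c" "p \<odot> b = Zero A Y (Cod A c)"
    using univ[OF cD(1) z] by blast
  have "epic A p" using epic_left_factor[OF a p(1)] p(2) cD(3) by simp
  then have "is_cokernel A p b"
  proof (rule cokernelI[OF b p(1) _ p(3)])
    fix T h assume h: "h \<in> Hom A P T" "h \<odot> b = Zero A Y T"
    have ha: "h \<odot> a \<in> Hom A X T" using Comp_closed[OF a h(1)] .
    have "h \<odot> a \<odot> f = h \<odot> b \<odot> g" using Comp_assoc[OF f a h(1)] Comp_assoc[OF g b h(1)] comm by simp
    then have "h \<odot> a \<odot> f = Zero A K T" using h(2) Comp_Zero_left[OF g] Hom_Obj[OF h(1)] by simp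
    then obtain u where u: "u \<in> Hom A (Cod A c) T" "u \<odot> c = h \<odot> a"
      using cokernel_factor[OF c f ha] by blast
    have "u \<odot> p \<odot> a = h \<odot> a" using Comp_assoc[OF a p(1) u(1)] p(2) u(2) by simp
    moreover have "u \<odot> p \<odot> b = h \<odot> b"
      using Comp_assoc[OF b p(1) u(1)] p(3) h(2) Comp_Zero_right[OF u(1)] obj by simp
    ultimately have "u \<odot> p = h" using joint[OF Comp_closed[OF p(1) u(1)] h(1)] by blast
    then show "\<exists>u\<in>Hom A (Cod A c) T. u \<odot> p = h" using u(1) by blast
  qed
  then show thesis using that p by blast
qed

text \<open>
  The pushout is the cokernel \<open>q\<close> of \<open>m = (f, -g)\<close> into the biproduct of \<open>X\<close> and \<open>Y\<close>. As
  \<open>f\<close> is monic, so is \<open>m\<close>, hence \<open>m\<close> is the kernel of \<open>q\<close>; an element of \<open>Y\<close> that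
  vanishes in the pushout comes from some \<open>t\<close> in \<open>K\<close> with \<open>f \<odot> t = 0\<close>.
\<close>

lemma ex_pushout_of_monic:
  assumes f: "f \<in> Hom A K X" "monic A f" and g: "g \<in> Hom A K Y"
  obtains P a b where "pushout K X Y P f g a b" "monic A b"
proof -
  have obj: "K \<in> Obj A" "X \<in> Obj A" "Y \<in> Obj A" using Hom_Obj f(1) g by blast+
  obtain B i1 i2 p1 p2 where "is_biproduct A X Y B i1 i2 p1 p2"
    using ex_biproduct obj by blast
  then have i1: "i1 \<in> Hom A X B" and i2: "i2 \<in> Hom A Y B"
    and p1: "p1 \<in> Hom A B X" and p2: "p2 \<in> Hom A B Y"
    and pi1: "p1 \<odot> i1 = Id A X" and pi2: "p2 \<odot> i2 = Id A Y"
    and sum: "i1 \<odot> p1 \<boxplus> i2 \<odot> p2 = Id A B"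
    unfolding is_biproduct_def by blast+
  have B: "B \<in> Obj A" using Hom_Obj[OF i1] by blast
  have ip1: "i1 \<odot> p1 \<in> Hom A B B" and ip2: "i2 \<odot> p2 \<in> Hom A B B"
    using Comp_closed[OF p1 i1] Comp_closed[OF p2 i2] by auto
  have mi1: "monic A i1" using monic_right_factor[OF i1 p1] pi1 monic_Id obj by simp
  have mi2: "monic A i2" using monic_right_factor[OF i2 p2] pi2 monic_Id obj by simp
  have p1i2: "p1 \<odot> i2 = Zero A Y X"
  proof -
    have "i2 = (i1 \<odot> p1 \<boxplus> i2 \<odot> p2) \<odot> i2" using sum Comp_Id_left[OF i2] by simp
    also have "\<dots> = i1 \<odot> (p1 \<odot> i2) \<boxplus> i2"
      using Comp_Add_left[OF i2 ip1 ip2] Comp_assoc[OF i2 p1 i1] Comp_assoc[OF i2 p2 i2]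
        pi2 Comp_Id_right[OF i2] by simp
    finally have "Zero A Y B \<boxplus> i2 = i1 \<odot> (p1 \<odot> i2) \<boxplus> i2" using Add_Zero[OF i2] by simp
    then have "Zero A Y B = i1 \<odot> (p1 \<odot> i2)"
      using Add_right_cancel[OF Zero_closed[OF obj(3) B] Comp_closed[OF Comp_closed[OF i2 p1] i1] i2]
      by blast
    then show ?thesis using monic_cancel_Zero[OF mi1 i1 Comp_closed[OF i2 p1]] by simp
  qed
  have p2i1: "p2 \<odot> i1 = Zero A X Y"
  proof -
    have "i1 = (i1 \<odot> p1 \<boxplus> i2 \<odot> p2) \<odot> i1" using sum Comp_Id_left[OF i1] by simp
    also have "\<dots> = i1 \<boxplus> i2 \<odot> (p2 \<odot> i1)"
      using Comp_Add_left[OF i1 ip1 ip2] Comp_assoc[OF i1 p1 i1] Comp_assoc[OF i1 p2 i2]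
        pi1 Comp_Id_right[OF i1] by simp
    finally have "i1 \<boxplus> Zero A X B = i1 \<boxplus> i2 \<odot> (p2 \<odot> i1)" using Add_Zero[OF i1] by simp
    then have "Zero A X B = i2 \<odot> (p2 \<odot> i1)"
      using Add_left_cancel[OF Zero_closed[OF obj(2) B] Comp_closed[OF Comp_closed[OF i1 p2] i2] i1]
      by blast
    then show ?thesis using monic_cancel_Zero[OF mi2 i2 Comp_closed[OF i1 p2]] by simp
  qed
  have split: "w = w \<odot> i1 \<odot> p1 \<boxplus> w \<odot> i2 \<odot> p2" if w: "w \<in> Hom A B T" for w T
  proof -
    have "w = w \<odot> (i1 \<odot> p1 \<boxplus> i2 \<odot> p2)" using sum Comp_Id_right[OF w] by simp
    then show ?thesis
      using Comp_Add_right[OF ip1 ip2 w] Comp_assoc[OF p1 i1 w] Comp_assoc[OF p2 i2 w] by simp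
  qed
  obtain g' where g': "g' \<in> Hom A K Y" "g \<boxplus> g' = Zero A K Y" using ex_negative[OF g] .
  define m where "m = i1 \<odot> f \<boxplus> i2 \<odot> g'"
  have if_: "i1 \<odot> f \<in> Hom A K B" and ig: "i2 \<odot> g' \<in> Hom A K B"
    using Comp_closed[OF f(1) i1] Comp_closed[OF g'(1) i2] by auto
  have m: "m \<in> Hom A K B" unfolding m_def using Add_closed[OF if_ ig] .
  have wm: "w \<odot> m = w \<odot> i1 \<odot> f \<boxplus> w \<odot> i2 \<odot> g'" if w: "w \<in> Hom A B T" for w T
    unfolding m_def
    using Comp_Add_right[OF if_ ig w] Comp_assoc[OF f(1) i1 w] Comp_assoc[OF g'(1) i2 w] by simp
  have p1m: "p1 \<odot> m = f"
    using wm[OF p1] pi1 p1i2 Comp_Id_left[OF f(1)] Comp_Zero_left[OF g'(1)] obj Add_Zero[OF f(1)]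
    by simp
  have mm: "monic A m" using monic_right_factor[OF m p1] p1m f(2) by simp
  obtain q where q: "is_cokernel A q m" using ex_cokernel HomD[OF m] by blast
  note qD = cokernelD[OF q m]
  let ?P = "Cod A q"
  have qk: "is_kernel A m q" using monic_kernel_of_cokernel[OF mm m q] .
  define a b where "a = q \<odot> i1" and "b = q \<odot> i2"
  have a: "a \<in> Hom A X ?P" and b: "b \<in> Hom A Y ?P"
    unfolding a_def b_def using Comp_closed[OF i1 qD(1)] Comp_closed[OF i2 qD(1)] by auto
  have P: "?P \<in> Obj A" using Hom_Obj[OF a] by blast
  have neg: "\<beta> \<odot> g \<boxplus> \<beta> \<odot> g' = Zero A K T" if \<beta>: "\<beta> \<in> Hom A Y T" for \<beta> T
    using Comp_Add_right[OF g g'(1) \<beta>] g'(2) Comp_Zero_right[OF \<beta> obj(1)] by simp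
  have "a \<odot> f \<boxplus> b \<odot> g' = b \<odot> g \<boxplus> b \<odot> g'"
    using wm[OF qD(1)] qD(2) neg[OF b] unfolding a_def b_def by simp
  then have comm: "a \<odot> f = b \<odot> g"
    using Add_right_cancel[OF Comp_closed[OF f(1) a] Comp_closed[OF g b] Comp_closed[OF g'(1) b]]
    by blast
  have univ: "\<exists>w \<in> Hom A ?P T. w \<odot> a = \<alpha> \<and> w \<odot> b = \<beta>"
    if \<alpha>: "\<alpha> \<in> Hom A X T" and \<beta>: "\<beta> \<in> Hom A Y T" and eq: "\<alpha> \<odot> f = \<beta> \<odot> g" for T \<alpha> \<beta>
  proof -
    have T: "T \<in> Obj A" using Hom_Obj[OF \<alpha>] by blast
    define w0 where "w0 = \<alpha> \<odot> p1 \<boxplus> \<beta> \<odot> p2"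
    have ap: "\<alpha> \<odot> p1 \<in> Hom A B T" and bp: "\<beta> \<odot> p2 \<in> Hom A B T"
      using Comp_closed[OF p1 \<alpha>] Comp_closed[OF p2 \<beta>] by auto
    have w0: "w0 \<in> Hom A B T" unfolding w0_def using Add_closed[OF ap bp] .
    have w1: "w0 \<odot> i1 = \<alpha>" unfolding w0_def
      using Comp_Add_left[OF i1 ap bp] Comp_assoc[OF i1 p1 \<alpha>] Comp_assoc[OF i1 p2 \<beta>] pi1 p2i1
        Comp_Id_right[OF \<alpha>] Comp_Zero_right[OF \<beta>] obj Add_Zero[OF \<alpha>] by simp
    have w2: "w0 \<odot> i2 = \<beta>" unfolding w0_def
      using Comp_Add_left[OF i2 ap bp] Comp_assoc[OF i2 p1 \<alpha>] Comp_assoc[OF i2 p2 \<beta>] pi2 p1i2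
        Comp_Id_right[OF \<beta>] Comp_Zero_right[OF \<alpha>] obj Add_Zero[OF \<beta>] by simp
    have "w0 \<odot> m = Zero A K T" using wm[OF w0] w1 w2 eq neg[OF \<beta>] by simp
    then obtain w where w: "w \<in> Hom A ?P T" "w \<odot> q = w0" using cokernel_factor[OF q m w0] by blast
    have "w \<odot> a = \<alpha>" "w \<odot> b = \<beta>" unfolding a_def b_def
      using Comp_assoc[OF i1 qD(1) w(1)] Comp_assoc[OF i2 qD(1) w(1)] w(2) w1 w2 by simp_all
    then show ?thesis using w(1) by blast
  qed
  have joint: "w = w'" if w: "w \<in> Hom A ?P T" and w': "w' \<in> Hom A ?P T"
    and e1: "w \<odot> a = w' \<odot> a" and e2: "w \<odot> b = w' \<odot> b" for T w w'
  proof -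
    have "w \<odot> q = w' \<odot> q"
      using split[OF Comp_closed[OF qD(1) w]] split[OF Comp_closed[OF qD(1) w']] e1 e2
      unfolding a_def b_def
      using Comp_assoc[OF i1 qD(1) w] Comp_assoc[OF i2 qD(1) w]
        Comp_assoc[OF i1 qD(1) w'] Comp_assoc[OF i2 qD(1) w'] by simp
    then show ?thesis using epic_cancel[OF qD(3,1) w w'] by blast
  qed
  have "pushout K X Y ?P f g a b"
    unfolding pushout_def using f(1) g a b comm univ joint by blast
  moreover have "monic A b"
  proof (rule monicI[OF b])
    fix T u assume u: "u \<in> Hom A T Y" "b \<odot> u = Zero A T ?P"
    have iu: "i2 \<odot> u \<in> Hom A T B" using Comp_closed[OF u(1) i2] .
    have "q \<odot> (i2 \<odot> u) = Zero A T ?P" using Comp_assoc[OF u(1) i2 qD(1)] u(2) b_def by simp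
    then obtain t where t: "t \<in> Hom A T K" "m \<odot> t = i2 \<odot> u"
      using kernel_factor[OF qk qD(1) iu] HomD[OF m] by metis
    have T: "T \<in> Obj A" using Hom_Obj[OF u(1)] by blast
    have "f \<odot> t = p1 \<odot> (m \<odot> t)" using Comp_assoc[OF t(1) m p1] p1m by simp
    also have "\<dots> = Zero A T X"
      using t(2) Comp_assoc[OF u(1) i2 p1] p1i2 Comp_Zero_left[OF u(1)] obj by simp
    finally have "t = Zero A T K" using monic_cancel_Zero[OF f(2,1) t(1)] by blast
    then have "i2 \<odot> u = Zero A T B" using t(2) Comp_Zero_right[OF m T] by simp
    then show "u = Zero A T Y" using monic_cancel_Zero[OF mi2 i2 u(1)] by blast
  qed
  ultimately show thesis using that by blast
qed

lemma kernel_image_short_exact: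
  assumes f: "f \<in> Hom A X Y" and k: "is_kernel A k f" and i: "is_image A i f"
  obtains e where "e \<in> Hom A X (Dom A i)" "short_exact A k e"
proof -
  obtain e where e: "e \<in> Hom A X (Dom A i)" "epic A e" "i \<odot> e = f"
    and iH: "i \<in> Hom A (Dom A i) Y" "monic A i"
    using image_factorization[OF f i] .
  note kD = kernelD[OF k f]
  have "is_kernel A k e"
  proof (rule kernelI[OF e(1) kD(1,3)])
    have "i \<odot> (e \<odot> k) = Zero A (Dom A k) Y" using Comp_assoc[OF kD(1) e(1) iH(1)] e(3) kD(2) by simp
    then show "e \<odot> k = Zero A (Dom A k) (Dom A i)"
      using monic_cancel_Zero[OF iH(2,1) Comp_closed[OF kD(1) e(1)]] by blast
    fix T h assume h: "h \<in> Hom A T X" "e \<odot> h = Zero A T (Dom A i)"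
    have "f \<odot> h = Zero A T Y"
      using Comp_assoc[OF h(1) e(1) iH(1)] e(3) h(2) Comp_Zero_right[OF iH(1)] Hom_Obj[OF h(1)] by simp
    then show "\<exists>u\<in>Hom A T (Dom A k). k \<odot> u = h" using kernel_factor[OF k f h(1)] by metis
  qed
  then have "short_exact A k e"
    unfolding short_exact_def using epic_cokernel_of_kernel[OF e(2,1)] by blast
  then show thesis using that e(1) by blast
qed

section \<open>Zero objects and length\<close>

lemma zero_object_Hom:
  assumes "zero_object A Z"
  shows "f \<in> Hom A X Z \<Longrightarrow> f = Zero A X Z" "f \<in> Hom A Z X \<Longrightarrow> f = Zero A Z X"
  using assms Zero_closed Hom_Obj unfolding zero_object_def by metis+

lemma zero_objectI:
  assumes X: "X \<in> Obj A" and id: "Id A X = Zero A X X"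
  shows "zero_object A X"
proof -
  have "f = Zero A Y X" if "f \<in> Hom A Y X" for Y f
    using Comp_Id_left[OF that] id Comp_Zero_left[OF that X] by simp
  moreover have "f = Zero A X Y" if "f \<in> Hom A X Y" for Y f
    using Comp_Id_right[OF that] id Comp_Zero_right[OF that X] by simp
  ultimately show ?thesis
    unfolding zero_object_def using X Zero_closed by blast
qed

lemma monic_into_zero_object:
  assumes m: "monic A m" "m \<in> Hom A K Z" and Z: "zero_object A Z"
  shows "zero_object A K" "isomorphism A m"
proof -
  have K: "K \<in> Obj A" using Hom_Obj[OF m(2)] by blast
  have "m \<odot> Id A K = Zero A K Z" using Comp_Id_right[OF m(2)] zero_object_Hom(1)[OF Z m(2)] by simp
  then show "zero_object A K"
    using monic_cancel_Zero[OF m Id_closed[OF K]] zero_objectI[OF K] by blast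
  have "epic A m" using epicI[OF m(2)] zero_object_Hom(2)[OF Z] by blast
  then show "isomorphism A m" using monic_epic_isomorphism[OF m] by blast
qed

inductive has_length :: "'a \<Rightarrow> nat \<Rightarrow> bool" where
  zero: "zero_object A M \<Longrightarrow> has_length M 0"
| extend: "\<lbrakk>short_exact A i p; simple_object A (Cod A p); has_length (Dom A i) n\<rbrakk>
    \<Longrightarrow> has_length (Cod A i) (Suc n)"

lemma finite_length_has_length:
  assumes "finite_length A M"
  shows "\<exists>n. has_length M n"
proof -
  obtain n :: nat and F i where F: "zero_object A (F 0)" "F n = M"
    and i: "\<And>k. k < n \<Longrightarrow> i k \<in> Hom A (F k) (F (Suc k)) \<and>
      (\<exists>p. short_exact A (i k) p \<and> simple_object A (Cod A p))"
    using assms unfolding finite_length_def by blast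
  have "k \<le> n \<Longrightarrow> has_length (F k) k" for k
  proof (induction k)
    case 0
    then show ?case using F zero by simp
  next
    case (Suc k)
    then obtain p where "i k \<in> Hom A (F k) (F (Suc k))" "short_exact A (i k) p"
      "simple_object A (Cod A p)" using i[of k] by auto
    then show ?case using extend[of "i k" p k] Suc by (auto simp: HomD)
  qed
  then show ?thesis using F(2) by blast
qed

text \<open>
  A composition series of \<open>M\<close> is intersected with \<open>K\<close>. If \<open>K\<close> maps to zero in the top
  factor, it lies in the next lower term of the series and gets a strictly shorter series. Otherwise
  it maps onto the simple top factor, and \<open>K\<close> is all of \<open>M\<close> once it contains the lower term.
\<close>

lemma subobject_has_length:
  assumes "has_length M n" "monic A m" "m \<in> Hom A K M"
  shows "\<exists>j\<le>n. has_length K j \<and> (j = n \<longrightarrow> isomorphism A m)"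
  using assms
proof (induction arbitrary: m K rule: has_length.induct)
  case (zero M)
  then show ?case using monic_into_zero_object[OF zero(2,3)] has_length.zero by auto
next
  case (extend i p n)
  let ?M = "Cod A i" and ?L = "Dom A i" and ?S = "Cod A p"
  have ip: "is_kernel A i p" and pc: "is_cokernel A p i"
    using extend.hyps unfolding short_exact_def by auto
  have p: "p \<in> Hom A ?M ?S" using kernel_Hom[OF ip] by blast
  note iD = kernelD[OF ip p]
  note pD = cokernelD[OF pc iD(1)]
  have m: "m \<in> Hom A K ?M" "monic A m" using extend.prems by auto
  have pm: "p \<odot> m \<in> Hom A K ?S" using Comp_closed[OF m(1) p] .
  obtain s where s: "is_image A s (p \<odot> m)" using ex_image[OF pm] .
  obtain e where e: "e \<in> Hom A K (Dom A s)" "epic A e" "s \<odot> e = p \<odot> m"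
    and sH: "s \<in> Hom A (Dom A s) ?S" "monic A s"
    using image_factorization[OF pm s] .
  have "zero_object A (Dom A s) \<or> isomorphism A s"
    using extend.hyps(2) sH HomD[OF sH(1)] unfolding simple_object_def by blast
  then show ?case
  proof
    assume "zero_object A (Dom A s)"
    then have "e = Zero A K (Dom A s)" using zero_object_Hom(1) e(1) by blast
    then have "p \<odot> m = Zero A K ?S" using e(3) Comp_Zero_right[OF sH(1)] Hom_Obj[OF m(1)] by simp
    then obtain m' where m': "m' \<in> Hom A K ?L" "i \<odot> m' = m" using kernel_factor[OF ip p m(1)] by blast
    have "monic A m'" using monic_right_factor[OF m'(1) iD(1)] m'(2) m(2) by simp
    then obtain j where "j \<le> n" "has_length K j" using extend.IH m'(1) by blast
    then show ?thesis by (intro exI[of _ j]) auto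
  next
    assume "isomorphism A s"
    then have epm: "epic A (p \<odot> m)" using epic_Comp[OF e(2,1) isomorphism_epic sH(1)] sH(1) e(3) by simp
    obtain k where k: "is_kernel A k (p \<odot> m)" using ex_kernel HomD[OF pm] by blast
    note kD = kernelD[OF k pm]
    have se: "short_exact A k (p \<odot> m)"
      unfolding short_exact_def using k epic_cokernel_of_kernel[OF epm pm k] by blast
    have mk: "m \<odot> k \<in> Hom A (Dom A k) ?M" using Comp_closed[OF kD(1) m(1)] .
    have "p \<odot> (m \<odot> k) = Zero A (Dom A k) ?S" using Comp_assoc[OF kD(1) m(1) p] kD(2) by simp
    then obtain m' where m': "m' \<in> Hom A (Dom A k) ?L" "i \<odot> m' = m \<odot> k"
      using kernel_factor[OF ip p mk] by blast
    have mm': "monic A m'"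
      using monic_right_factor[OF m'(1) iD(1)] m'(2) monic_Comp[OF kD(3,1) m(2,1)] by simp
    then obtain j where j: "j \<le> n" "has_length (Dom A k) j" "j = n \<longrightarrow> isomorphism A m'"
      using extend.IH m'(1) by blast
    have "has_length K (Suc j)"
      using has_length.extend[OF se _ j(2)] HomD[OF pm] HomD[OF kD(1)] extend.hyps(2) by simp
    moreover have "isomorphism A m" if "isomorphism A m'"
    proof -
      have "epic A m"
      proof (rule epicI[OF m(1)])
        fix T u assume u: "u \<in> Hom A ?M T" "u \<odot> m = Zero A K T"
        have T: "T \<in> Obj A" using Hom_Obj[OF u(1)] by blast
        have "u \<odot> i \<odot> m' = u \<odot> m \<odot> k"
          using Comp_assoc[OF m'(1) iD(1) u(1)] Comp_assoc[OF kD(1) m(1) u(1)] m'(2) by simp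
        then have "u \<odot> i \<odot> m' = Zero A (Dom A k) T" using u(2) Comp_Zero_left[OF kD(1) T] by simp
        then have "u \<odot> i = Zero A ?L T"
          using epic_cancel_Zero[OF isomorphism_epic[OF that m'(1)] m'(1) Comp_closed[OF iD(1) u(1)]]
          by blast
        then obtain v where v: "v \<in> Hom A ?S T" "v \<odot> p = u"
          using cokernel_factor[OF pc iD(1) u(1)] by blast
        have "v \<odot> (p \<odot> m) = Zero A K T" using Comp_assoc[OF m(1) p v(1)] v(2) u(2) by simp
        then have "v = Zero A ?S T" using epic_cancel_Zero[OF epm pm v(1)] by blast
        then show "u = Zero A ?M T" using v(2) Comp_Zero_left[OF p T] by simp
      qed
      then show ?thesis using monic_epic_isomorphism[OF m(2,1)] by blast
    qed
    ultimately show ?thesis using j by (intro exI[of _ "Suc j"]) auto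
  qed
qed

section \<open>Perpendicular classes\<close>

definition left_perp :: "'a set \<Rightarrow> 'a set" where
  "left_perp C = {U \<in> Obj A. \<forall>Y\<in>C. \<forall>u\<in>Hom A U Y. u = Zero A U Y}"

definition right_perp :: "'a set \<Rightarrow> 'a set" where
  "right_perp U = {Y \<in> Obj A. \<forall>X\<in>U. \<forall>u\<in>Hom A X Y. u = Zero A X Y}"

definition torsion_free_class :: "'a set \<Rightarrow> bool" where
  "torsion_free_class F \<longleftrightarrow> subcategory A F \<and> closed_under_extensions A F \<and>
    (\<forall>m. monic A m \<and> Cod A m \<in> F \<longrightarrow> Dom A m \<in> F)"

lemma torsion_free_class_right_perp: "torsion_free_class (right_perp U)"
proof -
  have sub: "X \<in> right_perp U" if m: "monic A m" "m \<in> Hom A X Y" and Y: "Y \<in> right_perp U" for m X Y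
  proof -
    have "u = Zero A T X" if T: "T \<in> U" and u: "u \<in> Hom A T X" for T u
      using monic_cancel_Zero[OF m u] Comp_closed[OF u m(2)] Y T unfolding right_perp_def by blast
    then show ?thesis using Hom_Obj[OF m(2)] unfolding right_perp_def by blast
  qed
  have "subcategory A (right_perp U)"
    unfolding subcategory_def
  proof (intro conjI ballI impI)
    show "right_perp U \<subseteq> Obj A" unfolding right_perp_def by blast
    obtain Z where Z: "zero_object A Z" using ex_zero_object by blast
    then have "Z \<in> right_perp U"
      using zero_object_Hom(1)[OF Z] unfolding right_perp_def zero_object_def by blast
    then show "\<exists>Z\<in>right_perp U. zero_object A Z" using Z by blast
    fix X Y assume X: "X \<in> right_perp U" and "isomorphic A X Y"
    then obtain f where f: "f \<in> Hom A X Y" "isomorphism A f" unfolding isomorphic_def by blast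
    then obtain g where g: "g \<in> Hom A Y X" "f \<odot> g = Id A Y" using isomorphismE by metis
    have "monic A g" using monic_right_factor[OF g(1) f(1)] g(2) monic_Id Hom_Obj[OF f(1)] by simp
    then show "Y \<in> right_perp U" using sub g(1) X by blast
  qed
  moreover have "closed_under_extensions A (right_perp U)"
    unfolding closed_under_extensions_def
  proof (intro allI impI, elim conjE)
    fix f g assume se: "short_exact A f g" and L: "Dom A f \<in> right_perp U" and N: "Cod A g \<in> right_perp U"
    have fg: "is_kernel A f g" using se unfolding short_exact_def by blast
    have g: "g \<in> Hom A (Cod A f) (Cod A g)" using kernel_Hom[OF fg] by blast
    note fD = kernelD[OF fg g]
    have "u = Zero A T (Cod A f)" if T: "T \<in> U" and u: "u \<in> Hom A T (Cod A f)" for T u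
    proof -
      have "g \<odot> u = Zero A T (Cod A g)"
        using N T Comp_closed[OF u g] unfolding right_perp_def by blast
      then obtain v where v: "v \<in> Hom A T (Dom A f)" "f \<odot> v = u"
        using kernel_factor[OF fg g u] by blast
      have "v = Zero A T (Dom A f)" using L T v(1) unfolding right_perp_def by blast
      then show ?thesis using v Comp_Zero_right[OF fD(1)] Hom_Obj[OF u] by simp
    qed
    then show "Cod A f \<in> right_perp U" using Hom_Obj[OF g] unfolding right_perp_def by blast
  qed
  moreover have "Dom A m \<in> right_perp U" if "monic A m" "Cod A m \<in> right_perp U" for m
    using sub[OF that(1) Arr_HomI that(2)] that(1) unfolding monic_def by blast
  ultimately show ?thesis unfolding torsion_free_class_def by blast
qed

lemma left_perp_quotient:
  assumes e: "epic A e" "e \<in> Hom A U V" and U: "U \<in> left_perp C"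
  shows "V \<in> left_perp C"
proof -
  have "v = Zero A V Y" if Y: "Y \<in> C" and v: "v \<in> Hom A V Y" for Y v
    using epic_cancel_Zero[OF e v] Comp_closed[OF e(2) v] U Y unfolding left_perp_def by blast
  then show ?thesis using Hom_Obj[OF e(2)] unfolding left_perp_def by blast
qed

lemma subset_right_left_perp: "C \<subseteq> Obj A \<Longrightarrow> C \<subseteq> right_perp (left_perp C)"
  unfolding right_perp_def left_perp_def by blast

section \<open>The wide subcategory attached to a torsion-free class\<close>

definition cokernel_stable :: "'a set \<Rightarrow> 'a set" where
  "cokernel_stable F = {X \<in> F. \<forall>Y\<in>F. \<forall>f\<in>Hom A X Y. \<forall>c. is_cokernel A c f \<longrightarrow> Cod A c \<in> F}"

lemma cokernel_stableI:
  assumes "X \<in> F" "\<And>Y f c. Y \<in> F \<Longrightarrow> f \<in> Hom A X Y \<Longrightarrow> is_cokernel A c f \<Longrightarrow> Cod A c \<in> F"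
  shows "X \<in> cokernel_stable F"
  using assms unfolding cokernel_stable_def by blast

lemma cokernel_stableD:
  assumes "X \<in> cokernel_stable F" "Y \<in> F" "f \<in> Hom A X Y" "is_cokernel A c f"
  shows "Cod A c \<in> F"
  using assms unfolding cokernel_stable_def by blast

text \<open>
  Dual to the wide subcategory that Ingalls and Thomas attach to a torsion class.
\<close>

lemma wide_cokernel_stable:
  assumes F: "torsion_free_class F"
  shows "wide_subcategory A (cokernel_stable F)"
proof -
  let ?W = "cokernel_stable F"
  have WF: "X \<in> F" if "X \<in> ?W" for X using that unfolding cokernel_stable_def by blast
  have Fobj: "F \<subseteq> Obj A" and Fiso: "\<And>X Y. X \<in> F \<Longrightarrow> Y \<in> Obj A \<Longrightarrow> isomorphic A X Y \<Longrightarrow> Y \<in> F"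
    and Fz: "\<exists>Z\<in>F. zero_object A Z"
    and Fsub: "\<And>m X Y. monic A m \<Longrightarrow> m \<in> Hom A X Y \<Longrightarrow> Y \<in> F \<Longrightarrow> X \<in> F"
    and Fext: "\<And>f g. short_exact A f g \<Longrightarrow> Dom A f \<in> F \<Longrightarrow> Cod A g \<in> F \<Longrightarrow> Cod A f \<in> F"
    using F HomD unfolding torsion_free_class_def subcategory_def closed_under_extensions_def
    by metis+
  have "subcategory A ?W"
    unfolding subcategory_def
  proof (intro conjI ballI impI)
    show "?W \<subseteq> Obj A" using WF Fobj by blast
    obtain Z where Z: "Z \<in> F" "zero_object A Z" using Fz by blast
    (* A morphism Z -> Y is zero, so its cokernel c has a left inverse u, which is also a right
       inverse because c is epic. *)
    have "Z \<in> ?W"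
    proof (rule cokernel_stableI[OF Z(1)])
      fix Y f c assume Y: "Y \<in> F" and f: "f \<in> Hom A Z Y" and c: "is_cokernel A c f"
      note cD = cokernelD[OF c f]
      have YO: "Y \<in> Obj A" using Y Fobj by blast
      have "Id A Y \<odot> f = Zero A Z Y" using zero_object_Hom(2)[OF Z(2) f] Comp_Id_left[OF f] by simp
      then obtain u where u: "u \<in> Hom A (Cod A c) Y" "u \<odot> c = Id A Y"
        using cokernel_factor[OF c f Id_closed[OF YO]] by blast
      have "c \<odot> u \<odot> c = Id A (Cod A c) \<odot> c"
        using Comp_assoc[OF cD(1) u(1) cD(1)] u(2) Comp_Id_right[OF cD(1)] Comp_Id_left[OF cD(1)] by simp
      then have "c \<odot> u = Id A (Cod A c)"
        using epic_cancel[OF cD(3,1) Comp_closed[OF u(1) cD(1)] Id_closed] Hom_Obj[OF cD(1)] by blast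
      then have "monic A u" using monic_right_factor[OF u(1) cD(1)] monic_Id Hom_Obj[OF cD(1)] by simp
      then show "Cod A c \<in> F" using Fsub u(1) Y by blast
    qed
    then show "\<exists>Z\<in>?W. zero_object A Z" using Z by blast
    fix X Y assume X: "X \<in> ?W" and Y: "Y \<in> Obj A" and XY: "isomorphic A X Y"
    then obtain q where q: "q \<in> Hom A X Y" "isomorphism A q" unfolding isomorphic_def by blast
    show "Y \<in> ?W"
    proof (rule cokernel_stableI)
      show "Y \<in> F" using Fiso[OF WF[OF X] Y XY] .
      fix T f c assume T: "T \<in> F" and f: "f \<in> Hom A Y T" and c: "is_cokernel A c f"
      have "is_cokernel A c (f \<odot> q)" using cokernel_Comp_epic[OF c f isomorphism_epic[OF q(2,1)] q(1)] .
      then show "Cod A c \<in> F" using cokernel_stableD[OF X T Comp_closed[OF q(1) f]] by blast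
    qed
  qed
  moreover have "closed_under_extensions A ?W"
    unfolding closed_under_extensions_def
  proof (intro allI impI, elim conjE)
    fix f g assume se: "short_exact A f g" and L: "Dom A f \<in> ?W" and N: "Cod A g \<in> ?W"
    have fg: "is_kernel A f g" and gf: "is_cokernel A g f" using se unfolding short_exact_def by auto
    have gH: "g \<in> Hom A (Cod A f) (Cod A g)" using kernel_Hom[OF fg] by blast
    note fD = kernelD[OF fg gH]
    note gD = cokernelD[OF gf fD(1)]
    show "Cod A f \<in> ?W"
    proof (rule cokernel_stableI)
      show "Cod A f \<in> F" using Fext[OF se] WF L N by blast
      fix Y h c assume Y: "Y \<in> F" and h: "h \<in> Hom A (Cod A f) Y" and c: "is_cokernel A c h"
      note cD = cokernelD[OF c h]
      have hf: "h \<odot> f \<in> Hom A (Dom A f) Y" using Comp_closed[OF fD(1) h] .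
      (* The cokernel of h is taken in two steps: first divide Y by the image of the subobject
         Dom f, then divide the result by the image of the quotient Cod g under the induced n. *)
      obtain d where d: "is_cokernel A d (h \<odot> f)" using ex_cokernel HomD[OF hf] by blast
      note dD = cokernelD[OF d hf]
      have dF: "Cod A d \<in> F" using cokernel_stableD[OF L Y hf d] .
      have dh: "d \<odot> h \<in> Hom A (Cod A f) (Cod A d)" using Comp_closed[OF h dD(1)] .
      have "d \<odot> h \<odot> f = Zero A (Dom A f) (Cod A d)" using Comp_assoc[OF fD(1) h dD(1)] dD(2) by simp
      then obtain n where n: "n \<in> Hom A (Cod A g) (Cod A d)" "n \<odot> g = d \<odot> h"
        using cokernel_factor[OF gf fD(1) dh] by blast
      have "c \<odot> (h \<odot> f) = Zero A (Dom A f) (Cod A c)"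
        using Comp_assoc[OF fD(1) h cD(1)] cD(2) Comp_Zero_left[OF fD(1)] Hom_Obj[OF cD(1)] by simp
      then obtain c1 where c1: "c1 \<in> Hom A (Cod A d) (Cod A c)" "c1 \<odot> d = c"
        using cokernel_factor[OF d hf cD(1)] by blast
      have "is_cokernel A c1 n"
      proof (rule cokernelI[OF n(1) c1(1)])
        show "epic A c1" using epic_left_factor[OF dD(1) c1(1)] c1(2) cD(3) by simp
        have "c1 \<odot> n \<odot> g = Zero A (Cod A f) (Cod A c)"
          using Comp_assoc[OF gD(1) n(1) c1(1)] n(2) Comp_assoc[OF h dD(1) c1(1)] c1(2) cD(2) by simp
        then show "c1 \<odot> n = Zero A (Cod A g) (Cod A c)"
          using epic_cancel_Zero[OF gD(3,1) Comp_closed[OF n(1) c1(1)]] by blast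
        fix T w assume w: "w \<in> Hom A (Cod A d) T" "w \<odot> n = Zero A (Cod A g) T"
        have wd: "w \<odot> d \<in> Hom A Y T" using Comp_closed[OF dD(1) w(1)] .
        have "w \<odot> d \<odot> h = w \<odot> n \<odot> g"
          using Comp_assoc[OF h dD(1) w(1)] Comp_assoc[OF gD(1) n(1) w(1)] n(2) by simp
        then have "w \<odot> d \<odot> h = Zero A (Cod A f) T"
          using w(2) Comp_Zero_left[OF gD(1)] Hom_Obj[OF w(1)] by simp
        then obtain v where v: "v \<in> Hom A (Cod A c) T" "v \<odot> c = w \<odot> d"
          using cokernel_factor[OF c h wd] by blast
        have "v \<odot> c1 \<odot> d = w \<odot> d" using Comp_assoc[OF dD(1) c1(1) v(1)] c1(2) v(2) by simp
        then have "v \<odot> c1 = w" using epic_cancel[OF dD(3,1) Comp_closed[OF c1(1) v(1)] w(1)] by blast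
        then show "\<exists>v\<in>Hom A (Cod A c) T. v \<odot> c1 = w" using v(1) by blast
      qed
      then show "Cod A c \<in> F" using cokernel_stableD[OF N dF n(1)] HomD[OF c1(1)] by metis
    qed
  qed
  moreover have "closed_under_kernels A ?W"
    unfolding closed_under_kernels_def
  proof (intro ballI allI impI)
    fix X X' f k assume X: "X \<in> ?W" and X': "X' \<in> ?W" and f: "f \<in> Hom A X X'" and k: "is_kernel A k f"
    note kD = kernelD[OF k f]
    show "Dom A k \<in> ?W"
    proof (rule cokernel_stableI)
      show "Dom A k \<in> F" using Fsub[OF kD(3,1)] WF X by blast
      fix Y g c assume Y: "Y \<in> F" and g: "g \<in> Hom A (Dom A k) Y" and c: "is_cokernel A c g"
      obtain i where i: "is_image A i f" using ex_image[OF f] .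
      have iF: "Dom A i \<in> F" using image_factorization[OF f i] Fsub WF X' by metis
      obtain e where e: "e \<in> Hom A X (Dom A i)" "short_exact A k e"
        using kernel_image_short_exact[OF f k i] .
      have ec: "is_cokernel A e k" using e(2) unfolding short_exact_def by blast
      (* The pushout P is an extension of the image of f by Y, hence in F, and X -> P has the
         same cokernel as g. *)
      obtain P a b where po: "pushout (Dom A k) X Y P k g a b" and mb: "monic A b"
        using ex_pushout_of_monic[OF kD(1,3) g] .
      have a: "a \<in> Hom A X P" and b: "b \<in> Hom A Y P" using po unfolding pushout_def by blast+
      obtain p where p: "p \<in> Hom A P (Cod A e)" "is_cokernel A p b" using pushout_cokernel[OF po ec] .
      have "short_exact A b p"
        unfolding short_exact_def using p monic_kernel_of_cokernel[OF mb b] by blast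
      then have "P \<in> F" using Fext[of b p] HomD[OF b] HomD[OF p(1)] HomD[OF e(1)] Y iF by simp
      moreover obtain q where q: "q \<in> Hom A P (Cod A c)" "is_cokernel A q a"
        using pushout_cokernel[OF pushout_swap[OF po] c] .
      ultimately show "Cod A c \<in> F" using cokernel_stableD[OF X _ a q(2)] HomD[OF q(1)] by simp
    qed
  qed
  moreover have "closed_under_cokernels A ?W"
    unfolding closed_under_cokernels_def
  proof (intro ballI allI impI)
    fix X X' f c assume X: "X \<in> ?W" and X': "X' \<in> ?W" and f: "f \<in> Hom A X X'" and c: "is_cokernel A c f"
    note cD = cokernelD[OF c f]
    show "Cod A c \<in> ?W"
    proof (rule cokernel_stableI)
      show "Cod A c \<in> F" using cokernel_stableD[OF X WF[OF X'] f c] .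
      fix Y g d assume Y: "Y \<in> F" and g: "g \<in> Hom A (Cod A c) Y" and d: "is_cokernel A d g"
      show "Cod A d \<in> F"
        using cokernel_stableD[OF X' Y Comp_closed[OF cD(1) g] cokernel_Comp_epic[OF d g cD(3,1)]] .
    qed
  qed
  ultimately show ?thesis unfolding wide_subcategory_def by blast
qed

end

section \<open>ICE-closed subcategories and their perpendicular classes\<close>

context abelian_length_category
begin

definition composition_length :: "'a \<Rightarrow> nat" where
  "composition_length M = (LEAST n. has_length M n)"

lemma subobject_of_full_length:
  assumes m: "monic A m" "m \<in> Hom A K M" and le: "composition_length M \<le> composition_length K"
  shows "isomorphism A m"
proof -
  have "has_length M (composition_length M)"
    unfolding composition_length_def
    using finite_length_has_length[OF all_finite_length] Hom_Obj[OF m(2)] LeastI_ex by metis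
  then obtain j where j: "j \<le> composition_length M" "has_length K j" "j = composition_length M \<longrightarrow> isomorphism A m"
    using subobject_has_length m by blast
  have "composition_length K \<le> j" unfolding composition_length_def using Least_le j(2) by metis
  then show ?thesis using j le by linarith
qed

text \<open>
  This is where extension-closure, images and finite length come together. By the hypothesis on
  \<open>r\<close>, a morphism from \<open>E\<close> to \<open>C\<close> is determined by its composite with \<open>x\<close>, so that \<open>E\<close>
  behaves like a quotient of \<open>X\<close>; membership of \<open>E\<close> in the double perpendicular class makes
  \<open>E\<close> embed into a single object of \<open>C\<close>.
\<close>

lemma mem_if_cokernel_in_left_perp:
  assumes C: "ICE_closed_subcategory A C" and E: "E \<in> right_perp (left_perp C)"
    and X: "X \<in> C" and x: "x \<in> Hom A X E" and r: "is_cokernel A r x" "Cod A r \<in> left_perp C"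
  shows "E \<in> C"
proof -
  have im: "\<And>f X Y i. f \<in> Hom A X Y \<Longrightarrow> X \<in> C \<Longrightarrow> Y \<in> C \<Longrightarrow> is_image A i f \<Longrightarrow> Dom A i \<in> C"
    and cok: "\<And>f X Y c. f \<in> Hom A X Y \<Longrightarrow> X \<in> C \<Longrightarrow> Y \<in> C \<Longrightarrow> is_cokernel A c f \<Longrightarrow> Cod A c \<in> C"
    and ext: "\<And>f g. short_exact A f g \<Longrightarrow> Dom A f \<in> C \<Longrightarrow> Cod A g \<in> C \<Longrightarrow> Cod A f \<in> C"
    using C unfolding ICE_closed_subcategory_def closed_under_images_def closed_under_cokernels_def
      closed_under_extensions_def by blast+
  obtain Z where Z: "Z \<in> C" "Z \<in> Obj A"
    using C unfolding ICE_closed_subcategory_def subcategory_def by blast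
  have EO: "E \<in> Obj A" using Hom_Obj[OF x] by blast
  note rD = cokernelD[OF r(1) x]
  (* Since morphisms from Cod r to C vanish, h and h x have the same cokernel and therefore the
     same image. *)
  have image_in_C: "\<exists>i. is_image A i h \<and> Dom A i \<in> C" if h: "h \<in> Hom A E Y" and Y: "Y \<in> C" for h Y
  proof -
    have hx: "h \<odot> x \<in> Hom A X Y" using Comp_closed[OF x h] .
    obtain c where c: "is_cokernel A c (h \<odot> x)" using ex_cokernel HomD[OF hx] by blast
    note cD = cokernelD[OF c hx]
    have ch: "c \<odot> h \<in> Hom A E (Cod A c)" using Comp_closed[OF h cD(1)] .
    have "c \<odot> h \<odot> x = Zero A X (Cod A c)" using Comp_assoc[OF x h cD(1)] cD(2) by simp
    then obtain v where v: "v \<in> Hom A (Cod A r) (Cod A c)" "v \<odot> r = c \<odot> h"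
      using cokernel_factor[OF r(1) x ch] by blast
    have "v = Zero A (Cod A r) (Cod A c)"
      using r(2) v(1) cok[OF hx X Y c] unfolding left_perp_def by blast
    then have ch0: "c \<odot> h = Zero A E (Cod A c)"
      using v(2) Comp_Zero_left[OF rD(1)] Hom_Obj[OF cD(1)] by simp
    have ch_cok: "is_cokernel A c h"
    proof (rule cokernelI[OF h cD(1,3) ch0])
      fix T w assume w: "w \<in> Hom A Y T" "w \<odot> h = Zero A E T"
      have "w \<odot> (h \<odot> x) = Zero A X T"
        using Comp_assoc[OF x h w(1)] w(2) Comp_Zero_left[OF x] Hom_Obj[OF w(1)] by simp
      then show "\<exists>u\<in>Hom A (Cod A c) T. u \<odot> c = w" using cokernel_factor[OF c hx w(1)] by metis
    qed
    obtain i where "is_kernel A i c" using ex_kernel HomD[OF cD(1)] by blast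
    then have "is_image A i h" "is_image A i (h \<odot> x)" unfolding is_image_def using c ch_cok by blast+
    then show ?thesis using im[OF hx X Y] by blast
  qed
  (* Choose a morphism h from E to C whose kernel has least length. *)
  define Q where "Q k \<longleftrightarrow> (\<exists>Y\<in>C. \<exists>h\<in>Hom A E Y. is_kernel A k h)" for k
  have z: "Zero A E Z \<in> Hom A E Z" using Zero_closed EO Z by blast
  then obtain k0 where "is_kernel A k0 (Zero A E Z)" using ex_kernel HomD by metis
  then have "Q k0" unfolding Q_def using z Z by blast
  then obtain k where k: "Q k" and least: "\<And>l. Q l \<Longrightarrow> composition_length (Dom A k) \<le> composition_length (Dom A l)"
    using ex_has_least_nat[of Q k0 "\<lambda>k. composition_length (Dom A k)"] by blast
  obtain Y h where Y: "Y \<in> C" and h: "h \<in> Hom A E Y" and kh: "is_kernel A k h"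
    using k unfolding Q_def by blast
  note kD = kernelD[OF kh h]
  let ?K = "Dom A k"
  obtain i where i: "is_image A i h" "Dom A i \<in> C" using image_in_C[OF h Y] by blast
  obtain e where e: "e \<in> Hom A E (Dom A i)" "short_exact A k e"
    using kernel_image_short_exact[OF h kh i(1)] .
  have ek: "is_cokernel A e k" using e(2) unfolding short_exact_def by blast
  note eD = cokernelD[OF ek kD(1)]
  have "g = Zero A ?K Y'" if Y': "Y' \<in> C" and g: "g \<in> Hom A ?K Y'" for Y' g
  proof -
    obtain P a b where po: "pushout ?K E Y' P k g a b" and mb: "monic A b"
      using ex_pushout_of_monic[OF kD(1,3) g] .
    have a: "a \<in> Hom A E P" and b: "b \<in> Hom A Y' P" and comm: "a \<odot> k = b \<odot> g"
      using po unfolding pushout_def by blast+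
    obtain p where p: "p \<in> Hom A P (Cod A e)" "p \<odot> a = e" "is_cokernel A p b"
      using pushout_cokernel[OF po ek] .
    have "short_exact A b p"
      unfolding short_exact_def using p monic_kernel_of_cokernel[OF mb b] by blast
    then have P: "P \<in> C" using ext[of b p] HomD[OF b] HomD[OF p(1)] HomD[OF e(1)] Y' i(2) by simp
    (* The kernel l of a lies in K, since e factors through a; by minimality it is all of K. *)
    obtain l where l: "is_kernel A l a" using ex_kernel HomD[OF a] by blast
    note lD = kernelD[OF l a]
    have "Q l" unfolding Q_def using P a l by blast
    then have le: "composition_length ?K \<le> composition_length (Dom A l)" using least by blast
    have "e \<odot> l = p \<odot> (a \<odot> l)" using Comp_assoc[OF lD(1) a p(1)] p(2) by simp
    then have "e \<odot> l = Zero A (Dom A l) (Cod A e)"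
      using lD(2) Comp_Zero_right[OF p(1)] Hom_Obj[OF lD(1)] by simp
    then obtain t where t: "t \<in> Hom A (Dom A l) ?K" "k \<odot> t = l"
      using kernel_factor[OF _ eD(1) lD(1)] e(2) unfolding short_exact_def by blast
    have "monic A t" using monic_right_factor[OF t(1) kD(1)] t(2) lD(3) by simp
    then have "isomorphism A t" using subobject_of_full_length t(1) le by blast
    then have et: "epic A t" using isomorphism_epic t(1) by blast
    have "a \<odot> k \<odot> t = Zero A (Dom A l) P" using Comp_assoc[OF t(1) kD(1) a] t(2) lD(2) by simp
    then have "a \<odot> k = Zero A ?K P" using epic_cancel_Zero[OF et t(1) Comp_closed[OF kD(1) a]] by blast
    then show ?thesis using monic_cancel_Zero[OF mb b g] comm by simp
  qed
  then have "?K \<in> left_perp C" using Hom_Obj[OF kD(1)] unfolding left_perp_def by blast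
  then have k0: "k = Zero A ?K E" using E kD(1) unfolding right_perp_def by blast
  have mh: "monic A h"
  proof (rule monicI[OF h])
    fix T u assume u: "u \<in> Hom A T E" "h \<odot> u = Zero A T Y"
    obtain v where v: "v \<in> Hom A T ?K" "k \<odot> v = u" using kernel_factor[OF kh h u] .
    then show "u = Zero A T E" using k0 Comp_Zero_left[OF v(1) EO] by simp
  qed
  obtain s where s: "s \<in> Hom A E (Dom A i)" "epic A s" "i \<odot> s = h"
    using image_factorization[OF h i(1)] by metis
  have "monic A s"
    using monic_right_factor[OF s(1)] image_factorization[OF h i(1)] s(3) mh by metis
  then have "isomorphism A s" using monic_epic_isomorphism s by blast
  then obtain t where t: "t \<in> Hom A (Dom A i) E" "t \<odot> s = Id A E" "s \<odot> t = Id A (Dom A i)"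
    using isomorphismE s(1) by blast
  have "isomorphic A (Dom A i) E"
    unfolding isomorphic_def using isomorphismI[OF t(1) s(1) t(3,2)] t(1) by blast
  then show ?thesis
    using C i(2) EO unfolding ICE_closed_subcategory_def subcategory_def by blast
qed

lemma quotient_mem_if_in_right_left_perp:
  assumes C: "ICE_closed_subcategory A C" and q: "epic A q" "q \<in> Hom A X E" and X: "X \<in> C"
    and E: "E \<in> right_perp (left_perp C)"
  shows "E \<in> C"
proof -
  obtain r where r: "is_cokernel A r q" using ex_cokernel HomD[OF q(2)] by blast
  note rD = cokernelD[OF r q(2)]
  have r0: "r = Zero A E (Cod A r)" using epic_cancel_Zero[OF q rD(1,2)] .
  have "v = Zero A (Cod A r) Y" if v: "v \<in> Hom A (Cod A r) Y" for v Y
  proof -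
    have "v \<odot> r = Zero A E Y"
      by (subst r0) (rule Comp_Zero_right[OF v], use Hom_Obj[OF q(2)] in blast)
    then show ?thesis using epic_cancel_Zero[OF rD(3,1) v] by blast
  qed
  then have "Cod A r \<in> left_perp C" using Hom_Obj[OF rD(1)] unfolding left_perp_def by blast
  then show ?thesis using mem_if_cokernel_in_left_perp[OF C E X q(2) r] by blast
qed

text \<open>
  This gives the inclusion of \<open>C\<close> in \<open>cokernel_stable (right_perp (left_perp C))\<close>. In the proof
  \<open>V\<close> is the image of a morphism \<open>U \<rightarrow> Cod d\<close> with \<open>U \<in> left_perp C\<close>, and \<open>E\<close> is its
  preimage in \<open>Y\<close>.
\<close>

lemma cokernel_in_right_left_perp:
  assumes C: "ICE_closed_subcategory A C" and X: "X \<in> C" and f: "f \<in> Hom A X Y"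
    and Y: "Y \<in> right_perp (left_perp C)" and d: "is_cokernel A d f"
  shows "Cod A d \<in> right_perp (left_perp C)"
proof -
  note dD = cokernelD[OF d f]
  let ?N = "Cod A d"
  have "u = Zero A U ?N" if U: "U \<in> left_perp C" and u: "u \<in> Hom A U ?N" for U u
  proof -
    obtain j where j: "is_image A j u" using ex_image[OF u] .
    let ?V = "Dom A j"
    obtain e where e: "e \<in> Hom A U ?V" "epic A e" "j \<odot> e = u" and jH: "j \<in> Hom A ?V ?N" "monic A j"
      using image_factorization[OF u j] .
    have V: "?V \<in> left_perp C" using left_perp_quotient[OF e(2,1) U] .
    have VO: "?V \<in> Obj A" "X \<in> Obj A" using Hom_Obj[OF jH(1)] Hom_Obj[OF f] by auto
    obtain c where c: "is_cokernel A c j" using ex_cokernel HomD[OF jH(1)] by blast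
    note cD = cokernelD[OF c jH(1)]
    have jc: "is_kernel A j c" using monic_kernel_of_cokernel[OF jH(2,1) c] .
    have cd: "c \<odot> d \<in> Hom A Y (Cod A c)" using Comp_closed[OF dD(1) cD(1)] .
    have ecd: "epic A (c \<odot> d)" using epic_Comp[OF dD(3,1) cD(3,1)] .
    obtain m where m: "is_kernel A m (c \<odot> d)" using ex_kernel HomD[OF cd] by blast
    note mD = kernelD[OF m cd]
    let ?E = "Dom A m"
    have mc: "is_cokernel A (c \<odot> d) m" using epic_cokernel_of_kernel[OF ecd cd m] .
    have E: "?E \<in> right_perp (left_perp C)"
      using torsion_free_class_right_perp Y mD(1,3) HomD[OF mD(1)] unfolding torsion_free_class_def
      by metis
    have dm: "d \<odot> m \<in> Hom A ?E ?N" using Comp_closed[OF mD(1) dD(1)] .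
    have "c \<odot> (d \<odot> m) = Zero A ?E (Cod A c)" using Comp_assoc[OF mD(1) dD(1) cD(1)] mD(2) by simp
    then obtain r where r: "r \<in> Hom A ?E ?V" "j \<odot> r = d \<odot> m"
      using kernel_factor[OF jc cD(1) dm] by blast
    have "c \<odot> d \<odot> f = Zero A X (Cod A c)"
      using Comp_assoc[OF f dD(1) cD(1)] dD(2) Comp_Zero_right[OF cD(1) VO(2)] by simp
    then obtain x where x: "x \<in> Hom A X ?E" "m \<odot> x = f" using kernel_factor[OF m cd f] by blast
    (* The pullback r of the epic d is epic: if w r = 0, then in the pushout P of j along w the
       morphism a d kills m, so a factors through c and a j = 0 = b w with b monic. *)
    have er: "epic A r"
    proof (rule epicI[OF r(1)])
      fix T w assume w: "w \<in> Hom A ?V T" "w \<odot> r = Zero A ?E T"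
      obtain P a b where po: "pushout ?V ?N T P j w a b" and mb: "monic A b"
        using ex_pushout_of_monic[OF jH w(1)] .
      have a: "a \<in> Hom A ?N P" and b: "b \<in> Hom A T P" and comm: "a \<odot> j = b \<odot> w"
        using po unfolding pushout_def by blast+
      have ad: "a \<odot> d \<in> Hom A Y P" using Comp_closed[OF dD(1) a] .
      have "a \<odot> d \<odot> m = a \<odot> j \<odot> r"
        using Comp_assoc[OF mD(1) dD(1) a] Comp_assoc[OF r(1) jH(1) a] r(2) by simp
      also have "\<dots> = b \<odot> (w \<odot> r)" using comm Comp_assoc[OF r(1) w(1) b] by simp
      also have "\<dots> = Zero A ?E P" using w(2) Comp_Zero_right[OF b] Hom_Obj[OF r(1)] by simp
      finally obtain y where y: "y \<in> Hom A (Cod A (c \<odot> d)) P" "y \<odot> (c \<odot> d) = a \<odot> d"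
        using cokernel_factor[OF mc mD(1) ad] by blast
      have yH: "y \<in> Hom A (Cod A c) P" using y(1) HomD[OF cd] by simp
      have "y \<odot> c \<odot> d = a \<odot> d" using Comp_assoc[OF dD(1) cD(1) yH] y(2) by simp
      then have "y \<odot> c = a" using epic_cancel[OF dD(3,1) Comp_closed[OF cD(1) yH] a] by blast
      then have "a \<odot> j = Zero A ?V P"
        using Comp_assoc[OF jH(1) cD(1) yH] cD(2) Comp_Zero_right[OF yH VO(1)] by simp
      then show "w = Zero A ?V T" using monic_cancel_Zero[OF mb b w(1)] comm by simp
    qed
    (* The kernel of r is the image of f, seen as a subobject of E. *)
    have rx: "is_cokernel A r x"
    proof (rule cokernelI[OF x(1) r(1) er])
      have "j \<odot> (r \<odot> x) = d \<odot> (m \<odot> x)"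
        using Comp_assoc[OF x(1) r(1) jH(1)] r(2) Comp_assoc[OF x(1) mD(1) dD(1)] by simp
      then show "r \<odot> x = Zero A X ?V"
        using monic_cancel_Zero[OF jH(2,1) Comp_closed[OF x(1) r(1)]] x(2) dD(2) by simp
      fix T v assume v: "v \<in> Hom A ?E T" "v \<odot> x = Zero A X T"
      have T: "T \<in> Obj A" using Hom_Obj[OF v(1)] by blast
      obtain i where id: "is_kernel A i d" using ex_kernel HomD[OF dD(1)] by blast
      have im: "is_image A i f" unfolding is_image_def using d id by blast
      note iD = kernelD[OF id dD(1)]
      obtain q where q: "q \<in> Hom A X (Dom A i)" "epic A q" "i \<odot> q = f"
        using image_factorization[OF f im] .
      have "c \<odot> d \<odot> i = Zero A (Dom A i) (Cod A c)"
        using Comp_assoc[OF iD(1) dD(1) cD(1)] iD(2) Comp_Zero_right[OF cD(1)] Hom_Obj[OF iD(1)] by simp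
      then obtain s where s: "s \<in> Hom A (Dom A i) ?E" "m \<odot> s = i" using kernel_factor[OF m cd iD(1)] by blast
      have "m \<odot> (s \<odot> q) = m \<odot> x" using Comp_assoc[OF q(1) s(1) mD(1)] s(2) q(3) x(2) by simp
      then have "s \<odot> q = x" using monic_cancel[OF mD(3,1) Comp_closed[OF q(1) s(1)] x(1)] by blast
      then have "v \<odot> s \<odot> q = Zero A X T" using Comp_assoc[OF q(1) s(1) v(1)] v(2) by simp
      then have vs: "v \<odot> s = Zero A (Dom A i) T"
        using epic_cancel_Zero[OF q(2,1) Comp_closed[OF s(1) v(1)]] by blast
      obtain k where k: "is_kernel A k r" using ex_kernel HomD[OF r(1)] by blast
      note kD = kernelD[OF k r(1)]
      have kO: "Dom A k \<in> Obj A" using Hom_Obj[OF kD(1)] by blast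
      have mk: "m \<odot> k \<in> Hom A (Dom A k) Y" using Comp_closed[OF kD(1) mD(1)] .
      have "d \<odot> (m \<odot> k) = j \<odot> (r \<odot> k)"
        using Comp_assoc[OF kD(1) mD(1) dD(1)] Comp_assoc[OF kD(1) r(1) jH(1)] r(2) by simp
      then have "d \<odot> (m \<odot> k) = Zero A (Dom A k) ?N" using kD(2) Comp_Zero_right[OF jH(1) kO] by simp
      then obtain w where w: "w \<in> Hom A (Dom A k) (Dom A i)" "i \<odot> w = m \<odot> k"
        using kernel_factor[OF id dD(1) mk] by blast
      have "m \<odot> (s \<odot> w) = m \<odot> k" using Comp_assoc[OF w(1) s(1) mD(1)] s(2) w(2) by simp
      then have "s \<odot> w = k" using monic_cancel[OF mD(3,1) Comp_closed[OF w(1) s(1)] kD(1)] by blast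
      then have "v \<odot> k = Zero A (Dom A k) T"
        using Comp_assoc[OF w(1) s(1) v(1)] vs Comp_Zero_left[OF w(1) T] by simp
      then show "\<exists>u\<in>Hom A ?V T. u \<odot> r = v"
        using cokernel_factor[OF epic_cokernel_of_kernel[OF er r(1) k] kD(1) v(1)] HomD[OF r(1)] by metis
    qed
    have rV: "Cod A r = ?V" using HomD[OF r(1)] by simp
    have "?E \<in> C" using mem_if_cokernel_in_left_perp[OF C E X x(1) rx] V rV by simp
    (* V lies in C and in its left perpendicular class, hence is zero. *)
    then have "?V \<in> C"
      using C X x(1) rx rV unfolding ICE_closed_subcategory_def closed_under_cokernels_def by metis
    then have "Id A ?V = Zero A ?V ?V" using V Id_closed[OF VO(1)] unfolding left_perp_def by blast
    then have "e = Zero A U ?V"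
      using Comp_Id_left[OF e(1)] Comp_Zero_left[OF e(1) VO(1)] by simp
    then show ?thesis using e(3) Comp_Zero_right[OF jH(1)] Hom_Obj[OF e(1)] by simp
  qed
  then show ?thesis using Hom_Obj[OF dD(1)] unfolding right_perp_def by blast
qed

end

section \<open>Wide subcategories as categories\<close>

lemma full_subcategory_simps [simp]:
  "Obj (full_subcategory A W) = W" "Dom (full_subcategory A W) = Dom A"
  "Cod (full_subcategory A W) = Cod A" "Id (full_subcategory A W) = Id A"
  "Comp (full_subcategory A W) = Comp A" "Zero (full_subcategory A W) = Zero A"
  "f \<in> Arr (full_subcategory A W) \<longleftrightarrow> f \<in> Arr A \<and> Dom A f \<in> W \<and> Cod A f \<in> W"
  "f \<in> Hom (full_subcategory A W) X Y \<longleftrightarrow> f \<in> Hom A X Y \<and> X \<in> W \<and> Y \<in> W"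
  by (auto simp: full_subcategory_def Hom_def)

lemma epic_full_subcategoryI:
  assumes "epic A f" "Dom A f \<in> W" "Cod A f \<in> W"
  shows "epic (full_subcategory A W) f"
  using assms unfolding epic_def Ball_def full_subcategory_simps by metis

lemma kernel_full_subcategoryI:
  assumes "is_kernel A k f" "Dom A k \<in> W" "Cod A k \<in> W" "Cod A f \<in> W"
  shows "is_kernel (full_subcategory A W) k f"
  using assms unfolding is_kernel_def Ball_def full_subcategory_simps by metis

lemma cokernel_full_subcategoryI:
  assumes "is_cokernel A c f" "Dom A f \<in> W" "Cod A f \<in> W" "Cod A c \<in> W"
  shows "is_cokernel (full_subcategory A W) c f"
  using assms unfolding is_cokernel_def Ball_def full_subcategory_simps by metis

lemma kernel_in_full_subcategory:
  assumes "is_kernel (full_subcategory A W) f g"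
  shows "Dom A f \<in> W" "Cod A f \<in> W" "Cod A g \<in> W" "f \<in> Hom A (Dom A f) (Cod A f)"
    "g \<in> Hom A (Cod A f) (Cod A g)" "g \<odot>\<^bsub>A\<^esub> f = Zero A (Dom A f) (Cod A g)"
    "\<And>X h. X \<in> W \<Longrightarrow> h \<in> Hom A X (Cod A f) \<Longrightarrow> g \<odot>\<^bsub>A\<^esub> h = Zero A X (Cod A g) \<Longrightarrow>
      \<exists>!u. u \<in> Hom A X (Dom A f) \<and> f \<odot>\<^bsub>A\<^esub> u = h"
proof -
  note f = assms[unfolded is_kernel_def Ball_def full_subcategory_simps]
  show "Dom A f \<in> W" "Cod A f \<in> W" "Cod A g \<in> W" "g \<odot>\<^bsub>A\<^esub> f = Zero A (Dom A f) (Cod A g)"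
    using f by metis+
  show "f \<in> Hom A (Dom A f) (Cod A f)" "g \<in> Hom A (Cod A f) (Cod A g)"
    using f by (metis Arr_HomI)+
  show "\<And>X h. X \<in> W \<Longrightarrow> h \<in> Hom A X (Cod A f) \<Longrightarrow> g \<odot>\<^bsub>A\<^esub> h = Zero A X (Cod A g) \<Longrightarrow>
      \<exists>!u. u \<in> Hom A X (Dom A f) \<and> f \<odot>\<^bsub>A\<^esub> u = h"
    using f by metis
qed

lemma cokernel_in_full_subcategory:
  assumes "is_cokernel (full_subcategory A W) g f"
  shows "Dom A f \<in> W" "Dom A g \<in> W" "Cod A g \<in> W" "g \<in> Hom A (Dom A g) (Cod A g)"
    "f \<in> Hom A (Dom A f) (Dom A g)" "g \<odot>\<^bsub>A\<^esub> f = Zero A (Dom A f) (Cod A g)"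
    "\<And>X h. X \<in> W \<Longrightarrow> h \<in> Hom A (Dom A g) X \<Longrightarrow> h \<odot>\<^bsub>A\<^esub> f = Zero A (Dom A f) X \<Longrightarrow>
      \<exists>!u. u \<in> Hom A (Cod A g) X \<and> u \<odot>\<^bsub>A\<^esub> g = h"
proof -
  note f = assms[unfolded is_cokernel_def Ball_def full_subcategory_simps]
  show "Dom A f \<in> W" "Dom A g \<in> W" "Cod A g \<in> W" "g \<odot>\<^bsub>A\<^esub> f = Zero A (Dom A f) (Cod A g)"
    using f by metis+
  show "g \<in> Hom A (Dom A g) (Cod A g)" "f \<in> Hom A (Dom A f) (Dom A g)"
    using f by (metis Arr_HomI)+
  show "\<And>X h. X \<in> W \<Longrightarrow> h \<in> Hom A (Dom A g) X \<Longrightarrow> h \<odot>\<^bsub>A\<^esub> f = Zero A (Dom A f) X \<Longrightarrow>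
      \<exists>!u. u \<in> Hom A (Cod A g) X \<and> u \<odot>\<^bsub>A\<^esub> g = h"
    using f by metis
qed

context abelian_category
begin

text \<open>
  A kernel in \<open>A\<close> lies in \<open>W\<close> and is therefore also a kernel there, so the two differ by an
  isomorphism.
\<close>

lemma kernel_full_subcategoryD:
  assumes W: "closed_under_kernels A W" and f: "is_kernel (full_subcategory A W) f g"
  shows "is_kernel A f g"
proof -
  note fW = kernel_in_full_subcategory(1-3)[OF f] and fH = kernel_in_full_subcategory(4)[OF f]
    and g = kernel_in_full_subcategory(5)[OF f] and gf = kernel_in_full_subcategory(6)[OF f]
    and univ = kernel_in_full_subcategory(7)[OF f]
  obtain k where k: "is_kernel A k g" using ex_kernel HomD[OF g] by blast
  note kD = kernelD[OF k g]
  have kW: "Dom A k \<in> W" using W fW g k unfolding closed_under_kernels_def by blast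
  obtain u where u: "u \<in> Hom A (Dom A f) (Dom A k)" "k \<odot> u = f" using kernel_factor[OF k g fH gf] .
  obtain v where v: "v \<in> Hom A (Dom A k) (Dom A f)" "f \<odot> v = k" using univ[OF kW kD(1,2)] by blast
  have O: "Dom A f \<in> Obj A" "Dom A k \<in> Obj A" using Hom_Obj[OF u(1)] by auto
  have "f \<odot> (v \<odot> u) = f" using Comp_assoc[OF u(1) v(1) fH] u(2) v(2) by simp
  then have vu: "v \<odot> u = Id A (Dom A f)"
    using univ[OF fW(1) fH gf] Comp_closed[OF u(1) v(1)] Id_closed[OF O(1)] Comp_Id_right[OF fH] by blast
  have "k \<odot> (u \<odot> v) = k \<odot> Id A (Dom A k)"
    using Comp_assoc[OF v(1) u(1) kD(1)] u(2) v(2) Comp_Id_right[OF kD(1)] by simp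
  then have "u \<odot> v = Id A (Dom A k)"
    using monic_cancel[OF kD(3,1) Comp_closed[OF v(1) u(1)] Id_closed[OF O(2)]] by blast
  then have "isomorphism A u" using isomorphismI[OF u(1) v(1) vu] by blast
  then show ?thesis using kernel_Comp_isomorphism[OF k u(1)] u(2) by simp
qed

lemma cokernel_full_subcategoryD:
  assumes W: "closed_under_cokernels A W" and g: "is_cokernel (full_subcategory A W) g f"
  shows "is_cokernel A g f"
proof -
  note gW = cokernel_in_full_subcategory(1-3)[OF g] and gH = cokernel_in_full_subcategory(4)[OF g]
    and f = cokernel_in_full_subcategory(5)[OF g] and gf = cokernel_in_full_subcategory(6)[OF g]
    and univ = cokernel_in_full_subcategory(7)[OF g]
  obtain c where c: "is_cokernel A c f" using ex_cokernel HomD[OF f] by blast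
  note cD = cokernelD[OF c f]
  have cW: "Cod A c \<in> W" using W gW f c unfolding closed_under_cokernels_def by blast
  obtain u where u: "u \<in> Hom A (Cod A c) (Cod A g)" "u \<odot> c = g" using cokernel_factor[OF c f gH gf] .
  obtain v where v: "v \<in> Hom A (Cod A g) (Cod A c)" "v \<odot> g = c" using univ[OF cW cD(1,2)] by blast
  have O: "Cod A g \<in> Obj A" "Cod A c \<in> Obj A" using Hom_Obj[OF u(1)] by auto
  have "u \<odot> v \<odot> g = g" using Comp_assoc[OF gH v(1) u(1)] u(2) v(2) by simp
  then have uv: "u \<odot> v = Id A (Cod A g)"
    using univ[OF gW(3) gH gf] Comp_closed[OF v(1) u(1)] Id_closed[OF O(1)] Comp_Id_left[OF gH] by blast
  have "v \<odot> u \<odot> c = Id A (Cod A c) \<odot> c"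
    using Comp_assoc[OF cD(1) u(1) v(1)] u(2) v(2) Comp_Id_left[OF cD(1)] by simp
  then have "v \<odot> u = Id A (Cod A c)"
    using epic_cancel[OF cD(3,1) Comp_closed[OF u(1) v(1)] Id_closed[OF O(2)]] by blast
  then have "isomorphism A u" using isomorphismI[OF u(1) v(1)] uv by blast
  then show ?thesis using cokernel_Comp_isomorphism[OF c u(1)] u(2) by simp
qed

lemma epic_full_subcategoryD:
  assumes W: "closed_under_cokernels A W" and f: "epic (full_subcategory A W) f"
  shows "epic A f"
proof -
  have fW: "Dom A f \<in> W" "Cod A f \<in> W" and fH: "f \<in> Hom A (Dom A f) (Cod A f)"
    and can: "\<And>X u v. X \<in> W \<Longrightarrow> u \<in> Hom A (Cod A f) X \<Longrightarrow> v \<in> Hom A (Cod A f) X \<Longrightarrow>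
      u \<odot> f = v \<odot> f \<Longrightarrow> u = v"
    using f unfolding epic_def by (auto simp: Arr_HomI)
  obtain c where c: "is_cokernel A c f" using ex_cokernel HomD[OF fH] by blast
  note cD = cokernelD[OF c fH]
  have cW: "Cod A c \<in> W" using W fW fH c unfolding closed_under_cokernels_def by blast
  have O: "Cod A c \<in> Obj A" "Cod A f \<in> Obj A" using Hom_Obj[OF cD(1)] by auto
  have c0: "c = Zero A (Cod A f) (Cod A c)"
    using can[OF cW cD(1) Zero_closed[OF O(2,1)]] cD(2) Comp_Zero_left[OF fH O(1)] by simp
  show ?thesis
  proof (rule epicI[OF fH])
    fix T u assume "u \<in> Hom A (Cod A f) T" "u \<odot> f = Zero A (Dom A f) T"
    then obtain w where w: "w \<in> Hom A (Cod A c) T" "w \<odot> c = u" using cokernel_factor[OF c fH] by blast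
    then show "u = Zero A (Cod A f) T" using c0 Comp_Zero_right[OF w(1) O(2)] by metis
  qed
qed

text \<open>
  The image of a morphism between objects of \<open>C\<close> is the kernel of its cokernel, hence lies in
  \<open>W\<close>, where it is a quotient of the source.
\<close>

lemma ICE_closed_if_torsion_class_in_wide:
  assumes W: "wide_subcategory A W" and T: "torsion_class (full_subcategory A W) C"
    and C: "subcategory A C"
  shows "ICE_closed_subcategory A C"
proof -
  let ?B = "full_subcategory A W"
  have CW: "C \<subseteq> W" using T unfolding torsion_class_def subcategory_def by simp
  have quot: "\<And>f. epic ?B f \<Longrightarrow> Dom A f \<in> C \<Longrightarrow> Cod A f \<in> C"
    and ext: "\<And>f g. short_exact ?B f g \<Longrightarrow> Dom A f \<in> C \<Longrightarrow> Cod A g \<in> C \<Longrightarrow> Cod A f \<in> C"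
    using T unfolding torsion_class_def closed_under_quotients_def closed_under_extensions_def by auto
  have Wext: "\<And>f g. short_exact A f g \<Longrightarrow> Dom A f \<in> W \<Longrightarrow> Cod A g \<in> W \<Longrightarrow> Cod A f \<in> W"
    and Wker: "\<And>f X Y k. f \<in> Hom A X Y \<Longrightarrow> X \<in> W \<Longrightarrow> Y \<in> W \<Longrightarrow> is_kernel A k f \<Longrightarrow> Dom A k \<in> W"
    and Wcok: "\<And>f X Y c. f \<in> Hom A X Y \<Longrightarrow> X \<in> W \<Longrightarrow> Y \<in> W \<Longrightarrow> is_cokernel A c f \<Longrightarrow> Cod A c \<in> W"
    using W unfolding wide_subcategory_def closed_under_extensions_def closed_under_kernels_def
      closed_under_cokernels_def by blast+
  have quotient: "Y \<in> C" if "epic A f" "f \<in> Hom A X Y" "X \<in> C" "Y \<in> W" for f X Y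
    using quot[OF epic_full_subcategoryI[OF that(1)]] that CW by (auto simp: HomD)
  have "closed_under_images A C"
    unfolding closed_under_images_def
  proof (intro ballI allI impI)
    fix X Y f i assume X: "X \<in> C" and Y: "Y \<in> C" and f: "f \<in> Hom A X Y" and i: "is_image A i f"
    obtain c where c: "is_cokernel A c f" "is_kernel A i c" using i unfolding is_image_def by blast
    have "Cod A c \<in> W" using Wcok[OF f _ _ c(1)] X Y CW by blast
    then have "Dom A i \<in> W" using Wker[OF cokernelD(1)[OF c(1) f] _ _ c(2)] Y CW by blast
    then show "Dom A i \<in> C" using image_factorization[OF f i] quotient X by metis
  qed
  moreover have "closed_under_cokernels A C"
    unfolding closed_under_cokernels_def
  proof (intro ballI allI impI)
    fix X Y f c assume X: "X \<in> C" and Y: "Y \<in> C" and f: "f \<in> Hom A X Y" and c: "is_cokernel A c f"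
    have "Cod A c \<in> W" using Wcok[OF f _ _ c] X Y CW by blast
    then show "Cod A c \<in> C" using quotient cokernelD(1,3)[OF c f] Y by blast
  qed
  moreover have "closed_under_extensions A C"
    unfolding closed_under_extensions_def
  proof (intro allI impI, elim conjE)
    fix f g assume se: "short_exact A f g" and fg: "Dom A f \<in> C" "Cod A g \<in> C"
    then have fW: "Cod A f \<in> W" "Dom A f \<in> W" "Cod A g \<in> W" using Wext CW by blast+
    have gf: "is_kernel A f g" "is_cokernel A g f" using se unfolding short_exact_def by auto
    have "short_exact ?B f g"
      unfolding short_exact_def
      using kernel_full_subcategoryI[OF gf(1) fW(2,1,3)] cokernel_full_subcategoryI[OF gf(2)] fW
        HomD[OF cokernel_Hom(1)[OF gf(2)]] HomD[OF kernel_Hom(1)[OF gf(1)]] by metis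
    then show "Cod A f \<in> C" using ext fg by blast
  qed
  ultimately show ?thesis unfolding ICE_closed_subcategory_def using C by blast
qed

end

section \<open>ICE-closed subcategories as torsion classes\<close>

lemma (in abelian_length_category) ICE_closed_torsion_class:
  assumes C: "ICE_closed_subcategory A C"
  defines "W \<equiv> cokernel_stable (right_perp (left_perp C))"
  shows "wide_subcategory A W" "torsion_class (full_subcategory A W) C"
proof -
  let ?F = "right_perp (left_perp C)" and ?B = "full_subcategory A W"
  show wide: "wide_subcategory A W"
    unfolding W_def using wide_cokernel_stable torsion_free_class_right_perp by blast
  have CO: "C \<subseteq> Obj A" and Ciso: "\<And>X Y. X \<in> C \<Longrightarrow> Y \<in> Obj A \<Longrightarrow> isomorphic A X Y \<Longrightarrow> Y \<in> C"
    and Cz: "\<exists>Z\<in>C. zero_object A Z" and Cext: "closed_under_extensions A C"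
    using C unfolding ICE_closed_subcategory_def subcategory_def by auto
  have CF: "C \<subseteq> ?F" using subset_right_left_perp[OF CO] .
  have CW: "C \<subseteq> W"
    unfolding W_def using CF cokernel_in_right_left_perp[OF C] cokernel_stableI by (meson subset_eq)
  have WF: "W \<subseteq> ?F" unfolding W_def cokernel_stable_def by blast
  have WO: "W \<subseteq> Obj A" and Wk: "closed_under_kernels A W" and Wc: "closed_under_cokernels A W"
    using wide unfolding wide_subcategory_def subcategory_def by auto
  have "subcategory ?B C"
    unfolding subcategory_def
  proof (intro conjI ballI impI)
    show "C \<subseteq> Obj ?B" using CW by simp
    obtain Z where Z: "Z \<in> C" "zero_object A Z" using Cz by blast
    then have ZW: "Z \<in> W" using CW by blast
    then have "zero_object ?B Z"
      using Z(2) subsetD[OF WO] unfolding zero_object_def by (simp add: ZW)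
    then show "\<exists>Z\<in>C. zero_object ?B Z" using Z by blast
    fix X Y assume X: "X \<in> C" and Y: "Y \<in> Obj ?B" and "isomorphic ?B X Y"
    then have "isomorphic A X Y"
      unfolding isomorphic_def isomorphism_def Bex_def full_subcategory_simps by blast
    then show "Y \<in> C" using Ciso X Y WO by auto
  qed
  moreover have "closed_under_extensions ?B C"
    using Cext kernel_full_subcategoryD[OF Wk] cokernel_full_subcategoryD[OF Wc]
    unfolding closed_under_extensions_def short_exact_def full_subcategory_simps by blast
  moreover have "closed_under_quotients ?B C"
    unfolding closed_under_quotients_def
  proof (intro allI impI, elim conjE)
    fix f assume f: "epic ?B f" and X: "Dom ?B f \<in> C"
    have "f \<in> Arr ?B" using f unfolding epic_def by blast
    then have "Cod A f \<in> ?F" "f \<in> Arr A" using subsetD[OF WF] by simp_all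
    then show "Cod ?B f \<in> C"
      using quotient_mem_if_in_right_left_perp[OF C epic_full_subcategoryD[OF Wc f] Arr_HomI] X by simp
  qed
  ultimately show "torsion_class ?B C" unfolding torsion_class_def by blast
qed

theorem theorem1:
  fixes A :: "('o, 'm) additive_data" and C :: "'o set"
  assumes "abelian_length_category A" and "subcategory A C"
  shows "ICE_closed_subcategory A C \<longleftrightarrow>
    (\<exists>W. wide_subcategory A W \<and> torsion_class (full_subcategory A W) C)"
proof -
  interpret abelian_length_category A by fact
  show ?thesis
    using ICE_closed_torsion_class ICE_closed_if_torsion_class_in_wide assms(2) by blast
qed

end
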